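(* Let $s>1$, $1<p<\infty$, $\lambda\in[n-1,n)$ and $\delta,\tau\in(0,1)$, and suppose \[ s<\frac{n+1-\lambda}{1-\delta},\qquad p>\frac{s(n-1)-\lambda+1}{n-s(1-\delta)-\lambda+1}. \] Let $G$ be an $s$-John domain in $\mathbb{R}^n$, $n\ge2$, with $\dim_{\mathcal M}(\partial G)\le\lambda$. Then there is $c<\infty$ such that for all $u\in L^p(G)$ \[ \int_G|u(x)-u_G|\,dx\le c\left(\int_G\int_{G\cap B^n(x,\tau\operatorname{dist}(x,\partial G))}\frac{|u(x)-u(y)|^p}{|x-y|^{n+\delta p}}\,dy\,dx\right)^{1/p}. \]
   Context: A bounded domain $G\subset\mathbb{R}^n$ is an $s$-John domain ($s\ge1$) if there are $x_0\in G$ and $c>0$ such that every $x\in G$ can be joined to $x_0$ by a rectifiable arc-length parametrized curve $\gamma:[0,l]\to G$ with $\gamma(0)=x$, $\gamma(l)=x_0$, $l\le c$, and $\operatorname{dist}(\gamma(t),\partial G)\ge t^s/c$ for $t\in[0,l]$. The upper Minkowski dimension of $E\subset\mathbb{R}^n$ is $\dim_{\mathcal M}(E)=\sup\{\lambda\ge0:\limsup_{r\to0+}|E+B^n(0,r)|\,r^{\lambda-n}=\infty\}$. $u_G$ is the mean of $u$ over $G$. *)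

theory Defs
  imports "HOL-Analysis.Analysis"
begin

definition curve_length :: "(real \<Rightarrow> 'a::real_normed_vector) \<Rightarrow> real \<Rightarrow> real \<Rightarrow> ereal" where
  "curve_length g a b =
     (SUP ts \<in> {ts :: real list. sorted ts \<and> ts \<noteq> [] \<and> hd ts = a \<and> last ts = b}.
        ereal (\<Sum>i<length ts - 1. norm (g (ts ! Suc i) - g (ts ! i))))"

definition arclength_param :: "(real \<Rightarrow> 'a::real_normed_vector) \<Rightarrow> real \<Rightarrow> bool" where
  "arclength_param g l \<longleftrightarrow> 0 \<le> l \<and>
     (\<forall>a b. 0 \<le> a \<and> a \<le> b \<and> b \<le> l \<longrightarrow> curve_length g a b = ereal (b - a))"

definition s_john_domain :: "real \<Rightarrow> 'a::euclidean_space set \<Rightarrow> bool" where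
  "s_john_domain s G \<longleftrightarrow> s \<ge> 1 \<and> bounded G \<and> open G \<and> connected G \<and>
     (\<exists>x0\<in>G. \<exists>c>0. \<forall>x\<in>G. \<exists>\<gamma> l.
        arclength_param \<gamma> l \<and> \<gamma> ` {0..l} \<subseteq> G \<and> \<gamma> 0 = x \<and> \<gamma> l = x0 \<and> l \<le> c \<and>
        (\<forall>t\<in>{0..l}. infdist (\<gamma> t) (frontier G) \<ge> t powr s / c))"

definition minkowski_dim :: "'a::euclidean_space set \<Rightarrow> real" where
  "minkowski_dim E = Sup {lam. lam \<ge> 0 \<and>
     Limsup (at_right 0)
       (\<lambda>r::real. emeasure lebesgue (E + ball 0 r) * ennreal (r powr (lam - real DIM('a)))) = \<infinity>}"

end

theory Submission
  imports Defs
begin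

text \<open>
  Vitali's covering lemma applied to the balls \<open>B(x, \<epsilon> d(x))\<close>, with \<open>d(x) = dist(x, \<partial>G)\<close>, gives a
  countable set \<open>A\<close> of centres whose balls are disjoint and whose fivefold enlargements cover \<open>G\<close>;
  it plays the role of a Whitney decomposition. Sampling the John curve of a centre \<open>a\<close> with steps
  \<open>\<epsilon> d\<close> gives a chain \<open>C(a)\<close> of centres, so that the averages satisfy
  \<open>\<bar>u_a - u_a0\<bar> \<le> (\<Sum>r\<in>C(a). g(r))\<close> with \<open>g(r)\<close> controlled by the local energy \<open>I_r\<close>. Instead of Hoelder's
  inequality the pointwise bound \<open>w \<le> K + K^(1-p) w^p\<close> is used, with
  \<open>K = J^(1/p) d(r)^\<beta>\<close>, \<open>J\<close> an upper bound of the energy on the right-hand side and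
  \<open>\<beta> = (\<delta>p - n + n/s)/(p - 1)\<close>. This makes \<open>g(r)\<close> a sum of two terms.

  The \<open>I_r\<close> term is summed over the shadow \<open>{a. r \<in> C(a)}\<close>, which lies in a ball of radius comparable to
  \<open>d(r)^(1/s)\<close>; this compensates the factor \<open>d(r)^(-n/s)\<close> exactly. For the other term,
  \<open>d(\<gamma>(t)) \<ge> k (t + d(a))^s\<close> along the curve yields \<open>(\<Sum>r\<in>C(a). d(r)^\<beta>) \<le> K d(a)^(-\<eta>)\<close> for every \<open>\<eta> > 0\<close>
  with \<open>\<eta> \<ge> s(1 - \<beta>) - 1\<close>, and \<open>(\<Sum>a\<in>A. d(a)^(n-\<eta>))\<close> is finite if \<open>\<eta> < n - \<lambda>\<close>. The hypothesis on \<open>p\<close> says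
  precisely that such an \<open>\<eta>\<close> exists.
\<close>

section \<open>Chains along John curves\<close>

text \<open>The chord is the sum belonging to the partition \<open>[a, b]\<close>, so the supremum
  defining the length dominates it.\<close>

lemma arclength_param_dist_le:
  assumes "arclength_param g l" "0 \<le> a" "a \<le> b" "b \<le> l"
  shows "dist (g a) (g b) \<le> b - a"
proof -
  have "ereal (norm (g b - g a)) \<le> curve_length g a b"
    unfolding curve_length_def
    by (rule SUP_upper2[of "[a, b]"]) (use assms in auto)
  also have "\<dots> = ereal (b - a)"
    using assms by (auto simp: arclength_param_def)
  finally show ?thesis by (simp add: dist_norm norm_minus_commute)
qed

text \<open>Mean value theorem for \<open>x powr - \<eta>\<close>: because
  \<open>b \<le> 2 * a\<close>, the derivative at the intermediate point is comparable to the one at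
  \<open>a\<close>. Terms of a Riemann sum can thus be replaced by telescoping differences.\<close>

lemma powr_diff_ge:
  fixes a b \<eta> :: real
  assumes "0 < a" "a \<le> b" "b \<le> 2 * a" "\<eta> > 0"
  shows "(b - a) * a powr (- \<eta> - 1) \<le> 2 powr (\<eta> + 1) / \<eta> * (a powr - \<eta> - b powr - \<eta>)"
proof (cases "a = b")
  case False
  hence ab: "a < b" using assms by simp
  have "\<exists>z. z > a \<and> z < b \<and> b powr - \<eta> - a powr - \<eta> = (b - a) * (- \<eta> * z powr (- \<eta> - 1))"
    using ab assms by (intro MVT2) (auto intro!: derivative_eq_intros)
  then obtain z where z: "a < z" "z < b"
    "b powr - \<eta> - a powr - \<eta> = (b - a) * (- \<eta> * z powr (- \<eta> - 1))" by blast
  have "(2 * a) powr (- \<eta> - 1) \<le> z powr (- \<eta> - 1)"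
    using assms z by (intro powr_mono2') auto
  hence "2 powr (- (\<eta> + 1)) * a powr (- \<eta> - 1) \<le> z powr (- \<eta> - 1)"
    by (simp add: powr_mult)
  hence "a powr (- \<eta> - 1) \<le> 2 powr (\<eta> + 1) * z powr (- \<eta> - 1)"
    unfolding powr_minus[of 2 "\<eta> + 1"] by (simp add: field_simps)
  hence "(b - a) * a powr (- \<eta> - 1) \<le> (b - a) * (2 powr (\<eta> + 1) * z powr (- \<eta> - 1))"
    using ab by (intro mult_left_mono) auto
  also have "\<dots> = 2 powr (\<eta> + 1) / \<eta> * (a powr - \<eta> - b powr - \<eta>)"
  proof -
    have "a powr - \<eta> - b powr - \<eta> = \<eta> * ((b - a) * z powr (- \<eta> - 1))"
      using z(3) by (simp add: algebra_simps)
    thus ?thesis using assms by simp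
  qed
  finally show ?thesis .
qed auto

text \<open>For \<open>t < r / 2\<close> the bound \<open>r - t \<le> y\<close> gives
  \<open>(t + r) / 3 \<le> y\<close>, and the missing power \<open>s - 1\<close> is absorbed using
  \<open>t + r \<le> 2 * D\<close>. For larger \<open>t\<close> one has
  \<open>t + r \<le> 3 * t\<close>, so the John condition suffices.\<close>

lemma john_lower_bound:
  fixes r D s c t y :: real
  assumes r: "0 < r" "r \<le> D" and s: "s \<ge> 1" and c: "c > 0" and t: "0 \<le> t"
    and y: "t powr s / c \<le> y" "r - t \<le> y"
  shows "min (1 / (c * 3 powr s)) (1 / (3 * (2 * D) powr (s - 1))) * (t + r) powr s \<le> y"
proof (cases "t \<ge> r / 2")
  case True
  have "min (1 / (c * 3 powr s)) (1 / (3 * (2 * D) powr (s - 1))) * (t + r) powr s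
      \<le> 1 / (c * 3 powr s) * (t + r) powr s"
    by (intro mult_right_mono) auto
  also have "\<dots> \<le> 1 / (c * 3 powr s) * (3 * t) powr s"
    using True r s c by (intro mult_left_mono powr_mono2) auto
  also have "\<dots> = t powr s / c"
    using t by (simp add: powr_mult)
  finally show ?thesis using y by simp
next
  case False
  have "(t + r) powr s = (t + r) * (t + r) powr (s - 1)"
    using r t by (simp add: powr_mult_base)
  also have "\<dots> \<le> (t + r) * (2 * D) powr (s - 1)"
    using r t s False by (intro mult_left_mono powr_mono2) auto
  finally have *: "(t + r) powr s \<le> (t + r) * (2 * D) powr (s - 1)" .
  have "min (1 / (c * 3 powr s)) (1 / (3 * (2 * D) powr (s - 1))) * (t + r) powr s
      \<le> 1 / (3 * (2 * D) powr (s - 1)) * (t + r) powr s"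
    by (intro mult_right_mono) auto
  also have "\<dots> \<le> 1 / (3 * (2 * D) powr (s - 1)) * ((t + r) * (2 * D) powr (s - 1))"
    using * by (intro mult_left_mono) auto
  also have "\<dots> = (t + r) / 3" using r by simp
  also have "\<dots> \<le> y" using False y by simp
  finally show ?thesis .
qed

text \<open>
  The exponent \<open>b\<close> is chosen so that \<open>s (b - 1) = - \<eta> - 1\<close>: since \<open>\<epsilon> d(z i)\<close> is the length of the
  \<open>i\<close>-th step, the sum is dominated by a telescoping sum of differences of \<open>(t + d(\<gamma> 0))^(-\<eta>)\<close>.
\<close>
lemma john_chain:
  fixes d :: "'a::metric_space \<Rightarrow> real" and \<gamma> :: "real \<Rightarrow> 'a"
  assumes lip: "\<And>x y. \<bar>d x - d y\<bar> \<le> dist x y"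
    and \<gamma>: "\<And>a b. 0 \<le> a \<Longrightarrow> a \<le> b \<Longrightarrow> b \<le> l \<Longrightarrow> dist (\<gamma> a) (\<gamma> b) \<le> b - a"
    and l: "0 \<le> l" and c: "c > 0" and s: "s > 1" and \<eta>: "\<eta> > 0" and \<epsilon>: "0 < \<epsilon>" "\<epsilon> \<le> 1"
    and john: "\<And>t. 0 \<le> t \<Longrightarrow> t \<le> l \<Longrightarrow> t powr s / c \<le> d (\<gamma> t)"
    and D: "0 < d (\<gamma> 0)" "d (\<gamma> 0) \<le> D"
  defines "b \<equiv> 1 - (1 + \<eta>) / s"
    and "k \<equiv> min (1 / (c * 3 powr s)) (1 / (3 * (2 * D) powr (s - 1)))"
  shows "\<exists>z N. z 0 = \<gamma> 0 \<and> z N = \<gamma> l \<and> (\<forall>i\<le>N. z i \<in> \<gamma> ` {0..l}) \<and>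
           (\<forall>i<N. dist (z i) (z (Suc i)) \<le> \<epsilon> * d (z i)) \<and>
           (\<forall>i\<le>N. dist (\<gamma> 0) (z i) \<le> (c * d (z i)) powr (1 / s)) \<and>
           (\<Sum>i\<le>N. d (z i) powr b)
             \<le> k powr (b - 1) * (2 powr (\<eta> + 1) / (\<eta> * \<epsilon>) + 1) * d (\<gamma> 0) powr - \<eta>"
proof -
  define r where "r = d (\<gamma> 0)"
  have r: "r > 0" using D by (simp add: r_def)
  have k: "k > 0" using D c by (simp add: k_def)
  have low: "k * (t + r) powr s \<le> d (\<gamma> t)" and up: "d (\<gamma> t) \<le> t + r"
    if "0 \<le> t" "t \<le> l" for t
  proof -
    have "\<bar>d (\<gamma> 0) - d (\<gamma> t)\<bar> \<le> t"
      using lip[of "\<gamma> 0" "\<gamma> t"] \<gamma>[of 0 t] that by linarith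
    hence *: "r - t \<le> d (\<gamma> t)" "d (\<gamma> t) \<le> t + r" by (auto simp: r_def)
    show "d (\<gamma> t) \<le> t + r" by fact
    show "k * (t + r) powr s \<le> d (\<gamma> t)"
      unfolding k_def using * that D c s john[OF that]
      by (intro john_lower_bound) (auto simp: r_def)
  qed
  have pos: "d (\<gamma> t) > 0" if "0 \<le> t" "t \<le> l" for t
  proof -
    have "0 < k * (t + r) powr s" using k r that by simp
    thus ?thesis using low[OF that] by linarith
  qed
  have pow: "d (\<gamma> t) powr (b - 1) \<le> k powr (b - 1) * (t + r) powr (- \<eta> - 1)"
    if "0 \<le> t" "t \<le> l" for t
  proof -
    have "d (\<gamma> t) powr (b - 1) \<le> (k * (t + r) powr s) powr (b - 1)"
      using low[OF that] k r that s \<eta> by (intro powr_mono2') (auto simp: b_def)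
    also have "\<dots> = k powr (b - 1) * (t + r) powr (s * (b - 1))"
      using k r that by (simp add: powr_mult powr_powr)
    also have "s * (b - 1) = - \<eta> - 1" using s by (simp add: b_def field_simps)
    finally show ?thesis .
  qed
  \<comment> \<open>Freezing the curve at its end point keeps the recursion for the sampling times
    meaningful past \<open>l\<close>.\<close>
  define g where "g t = \<gamma> (min t l)" for t
  define T where "T = rec_nat 0 (\<lambda>_ t. t + \<epsilon> * d (g t))"
  have T0: "T 0 = 0" and TS: "T (Suc i) = T i + \<epsilon> * d (g (T i))" for i
    by (auto simp: T_def)
  have Tnn: "T i \<ge> 0" for i
  proof (induction i)
    case (Suc i)
    thus ?case using pos[of "min (T i) l"] l \<epsilon> by (auto simp: TS g_def min_def)
  qed (simp add: T0)
  have gpos: "d (g (T i)) > 0" for i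
    using pos[of "min (T i) l"] l Tnn by (auto simp: g_def)
  \<comment> \<open>A positive lower bound for \<open>d\<close> along the whole curve: every step
    advances the time by at least \<open>\<epsilon> * m\<close>, so \<open>l\<close> is reached
    after finitely many steps.\<close>
  define m where "m = k * r powr s"
  have m: "m > 0" using k r by (simp add: m_def)
  have gm: "d (g (T i)) \<ge> m" for i
  proof -
    have "m \<le> k * (min (T i) l + r) powr s"
      unfolding m_def using k r l Tnn s by (intro mult_left_mono powr_mono2) auto
    also have "\<dots> \<le> d (g (T i))" unfolding g_def using l Tnn by (intro low) auto
    finally show ?thesis .
  qed
  have Tm: "T i \<ge> real i * (\<epsilon> * m)" for i
  proof (induction i)
    case (Suc i)
    have "\<epsilon> * m \<le> \<epsilon> * d (g (T i))" using gm \<epsilon> by (intro mult_left_mono) auto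
    thus ?case using Suc by (simp add: TS algebra_simps)
  qed (simp add: T0)
  have "\<exists>N. T N \<ge> l"
  proof -
    obtain N where "real N * (\<epsilon> * m) > l" using ex_less_of_nat_mult[of "\<epsilon> * m" l] \<epsilon> m by auto
    thus ?thesis using Tm[of N] by (intro exI[of _ N]) linarith
  qed
  \<comment> \<open>Minimality makes every sample before index \<open>N\<close> a genuine curve
    point at its own time \<open>T i\<close>, where \<open>pow\<close> and \<open>up\<close>
    apply.\<close>
  define N where "N = (LEAST N. T N \<ge> l)"
  have N: "T N \<ge> l" unfolding N_def by (rule LeastI_ex) fact
  have Nl: "T i < l" if "i < N" for i
    using not_less_Least[of i "\<lambda>N. T N \<ge> l"] that by (auto simp: N_def)
  define z where "z i = g (T i)" for i
  have zin: "z i \<in> \<gamma> ` {0..l}" for i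
    using Tnn[of i] l by (auto simp: z_def g_def)
  have gT: "z i = \<gamma> (T i)" if "i < N" for i
    using Nl[OF that] by (simp add: z_def g_def)
  have zN: "z N = \<gamma> l" using N by (simp add: z_def g_def)
  have step: "dist (z i) (z (Suc i)) \<le> \<epsilon> * d (z i)" for i
  proof -
    have le: "T i \<le> T (Suc i)" using gpos[of i] \<epsilon> by (simp add: TS)
    have "dist (z i) (z (Suc i)) \<le> min (T (Suc i)) l - min (T i) l"
      unfolding z_def g_def by (rule \<gamma>) (use le Tnn l in auto)
    also have "\<dots> \<le> T (Suc i) - T i" using le by (auto simp: min_def)
    finally show ?thesis by (simp add: TS z_def)
  qed
  \<comment> \<open>The John condition at time \<open>t\<close> is solved for \<open>t\<close>,
    which bounds the distance from the start.\<close>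
  have far: "dist (\<gamma> 0) (z i) \<le> (c * d (z i)) powr (1 / s)" for i
  proof -
    define t where "t = min (T i) l"
    have t: "0 \<le> t" "t \<le> l" using Tnn[of i] l by (auto simp: t_def)
    have "dist (\<gamma> 0) (z i) \<le> t" using \<gamma>[of 0 t] t by (simp add: z_def g_def t_def)
    also have "t = (t powr s) powr (1 / s)" using t s by (simp add: powr_powr)
    also have "\<dots> \<le> (c * d (z i)) powr (1 / s)"
      using john[OF t] c s by (intro powr_mono2) (auto simp: z_def g_def t_def field_simps)
    finally show ?thesis .
  qed
  have main: "d (z i) powr b \<le> k powr (b - 1) * (2 powr (\<eta> + 1) / (\<eta> * \<epsilon>)) *
      ((T i + r) powr - \<eta> - (T (Suc i) + r) powr - \<eta>)" if i: "i < N" for i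
  proof -
    have t: "0 \<le> T i" "T i \<le> l" using Tnn Nl[OF i] by (auto intro: less_imp_le)
    \<comment> \<open>The time increment supplies one factor \<open>d (z i)\<close>; the remaining
      power \<open>b - 1\<close> is controlled by \<open>pow\<close>.\<close>
    have d: "d (z i) = (T (Suc i) - T i) / \<epsilon>" using \<epsilon> by (simp add: TS z_def)
    have dpos: "d (z i) > 0" using gpos by (simp add: z_def)
    have "d (z i) powr b = d (z i) * d (z i) powr (b - 1)"
      using dpos by (simp add: powr_mult_base)
    also have "\<dots> \<le> d (z i) * (k powr (b - 1) * (T i + r) powr (- \<eta> - 1))"
      using pow[OF t] dpos by (intro mult_left_mono) (auto simp: gT[OF i])
    also have "\<dots> = k powr (b - 1) / \<epsilon> * (((T (Suc i) + r) - (T i + r)) * (T i + r) powr (- \<eta> - 1))"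
      unfolding d using \<epsilon> by (simp add: field_simps)
    also have "\<dots> \<le> k powr (b - 1) / \<epsilon> * (2 powr (\<eta> + 1) / \<eta> * ((T i + r) powr - \<eta> - (T (Suc i) + r) powr - \<eta>))"
    proof (intro mult_left_mono powr_diff_ge)
      have "\<epsilon> * d (z i) \<le> 1 * d (z i)" using \<epsilon> dpos by (intro mult_right_mono) auto
      also have "\<dots> \<le> T i + r" using up[OF t] by (simp add: gT[OF i])
      finally show "T (Suc i) + r \<le> 2 * (T i + r)" by (simp add: TS z_def)
      show "T i + r \<le> T (Suc i) + r" using dpos \<epsilon> by (simp add: TS z_def)
    qed (use t r \<eta> \<epsilon> in auto)
    finally show ?thesis by (simp add: mult_ac)
  qed
  \<comment> \<open>The final sample has no full step to telescope against, so its term is estimated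
    directly from \<open>d (z N) \<le> l + r\<close>; it accounts for the \<open>+ 1\<close> in the
    constant.\<close>
  have last: "d (z N) powr b \<le> k powr (b - 1) * r powr - \<eta>"
  proof -
    have dpos: "d (z N) > 0" using gpos by (simp add: z_def)
    have "d (z N) powr b = d (z N) * d (z N) powr (b - 1)"
      using dpos by (simp add: powr_mult_base)
    also have "\<dots> \<le> (l + r) * (k powr (b - 1) * (l + r) powr (- \<eta> - 1))"
      using pow[of l] up[of l] l r dpos by (intro mult_mono) (auto simp: zN)
    also have "\<dots> = k powr (b - 1) * ((l + r) * (l + r) powr (- \<eta> - 1))" by simp
    also have "(l + r) * (l + r) powr (- \<eta> - 1) = (l + r) powr - \<eta>"
      using l r by (simp add: powr_mult_base)
    also have "k powr (b - 1) * (l + r) powr - \<eta> \<le> k powr (b - 1) * r powr - \<eta>"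
      using l r \<eta> by (intro mult_left_mono powr_mono2') auto
    finally show ?thesis .
  qed
  have "(\<Sum>i<N. d (z i) powr b) \<le> (\<Sum>i<N. k powr (b - 1) * (2 powr (\<eta> + 1) / (\<eta> * \<epsilon>)) *
      ((T i + r) powr - \<eta> - (T (Suc i) + r) powr - \<eta>))"
    by (intro sum_mono main) auto
  also have "\<dots> = k powr (b - 1) * (2 powr (\<eta> + 1) / (\<eta> * \<epsilon>)) *
      (r powr - \<eta> - (T N + r) powr - \<eta>)"
    unfolding sum_distrib_left[symmetric] by (subst sum_lessThan_telescope') (simp add: T0)
  also have "\<dots> \<le> k powr (b - 1) * (2 powr (\<eta> + 1) / (\<eta> * \<epsilon>)) * r powr - \<eta>"
    using \<eta> \<epsilon> by (intro mult_left_mono) auto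
  finally have "(\<Sum>i\<le>N. d (z i) powr b) \<le>
      k powr (b - 1) * (2 powr (\<eta> + 1) / (\<eta> * \<epsilon>)) * r powr - \<eta> + k powr (b - 1) * r powr - \<eta>"
    using last by (simp add: lessThan_Suc_atMost[symmetric])
  also have "\<dots> = k powr (b - 1) * (2 powr (\<eta> + 1) / (\<eta> * \<epsilon>) + 1) * r powr - \<eta>"
    by (simp add: algebra_simps)
  finally have "(\<Sum>i\<le>N. d (z i) powr b) \<le>
    k powr (b - 1) * (2 powr (\<eta> + 1) / (\<eta> * \<epsilon>) + 1) * d (\<gamma> 0) powr - \<eta>"
    by (simp add: r_def)
  moreover have "z 0 = \<gamma> 0" using l by (simp add: z_def g_def T0)
  ultimately show ?thesis
    using zN zin step far by (intro exI[of _ z] exI[of _ N]) auto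
qed

text \<open>Every vertex is counted once because the walk is continued from its last visit to the vertex.\<close>
lemma walk_sum:
  fixes f :: "'a \<Rightarrow> real" and v :: "nat \<Rightarrow> 'a"
  assumes step: "\<And>i. i < N \<Longrightarrow> \<bar>f (v i) - f (v (Suc i))\<bar> \<le> g (v i)"
    and nn: "\<And>i. i \<le> N \<Longrightarrow> 0 \<le> g (v i)"
  shows "\<bar>f (v 0) - f (v N)\<bar> \<le> (\<Sum>a\<in>v ` {..N}. g a)"
proof -
  have "\<bar>f (v k) - f (v N)\<bar> \<le> (\<Sum>a\<in>v ` {k..N}. g a)" if "k \<le> N" for k
    using that
  proof (induction "N - k" arbitrary: k rule: less_induct)
    case less
    define m where "m = Max {i\<in>{k..N}. v i = v k}"
    have m: "m \<in> {i\<in>{k..N}. v i = v k}"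
      unfolding m_def using less.prems by (intro Max_in) auto
    have mmax: "v i \<noteq> v k" if "m < i" "i \<le> N" for i
    proof
      assume "v i = v k"
      hence "i \<in> {i\<in>{k..N}. v i = v k}" using that m by auto
      hence "i \<le> m" unfolding m_def by (intro Max_ge) auto
      thus False using that by simp
    qed
    show ?case
    proof (cases "m = N")
      case True
      thus ?thesis using m nn by (auto intro!: sum_nonneg)
    next
      case False
      hence mN: "m < N" "k \<le> m" "v m = v k" using m by auto
      have notin: "v k \<notin> v ` {Suc m..N}"
        by (metis Suc_le_eq atLeastAtMost_iff imageE mmax)
      have "\<bar>f (v k) - f (v N)\<bar> \<le> \<bar>f (v m) - f (v (Suc m))\<bar> + \<bar>f (v (Suc m)) - f (v N)\<bar>"
        using mN by simp
      also have "\<dots> \<le> g (v k) + (\<Sum>a\<in>v ` {Suc m..N}. g a)"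
        using mN step[of m] less.hyps[of "Suc m"] by (intro add_mono) auto
      also have "\<dots> = (\<Sum>a\<in>insert (v k) (v ` {Suc m..N}). g a)"
        using notin by simp
      also have "\<dots> \<le> (\<Sum>a\<in>v ` {k..N}. g a)"
        using mN nn by (intro sum_mono2) auto
      finally show ?thesis .
    qed
  qed
  from this[of 0] show ?thesis by (simp add: atLeast0AtMost)
qed

section \<open>The Whitney-type cover\<close>

text \<open>\<open>A\<close> is the set of centres; the constant 20 in \<open>adjacent\<close> leaves room for neighbouring cells.\<close>
locale whitney_cover =
  fixes G A :: "'a::euclidean_space set" and \<epsilon> D :: real
  assumes openG: "open G" and bndG: "bounded G" and AG: "A \<subseteq> G" and cA: "countable A"
    and eps: "0 < \<epsilon>" "\<epsilon> \<le> 1 / 100"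
    and disj: "disjoint_family_on (\<lambda>a. cball a (\<epsilon> * infdist a (frontier G))) A"
    and cover: "G \<subseteq> (\<Union>a\<in>A. cball a (5 * (\<epsilon> * infdist a (frontier G))))"
    and frG: "frontier G \<noteq> {}"
    and D: "\<And>x. x \<in> G \<Longrightarrow> infdist x (frontier G) \<le> D"
begin

abbreviation d :: "'a \<Rightarrow> real" where
  "d x \<equiv> infdist x (frontier G)"

text \<open>The inclusion is one-sided because a difference of averages will be charged to the
  energy of the first cell alone.\<close>

definition adjacent :: "'a \<Rightarrow> 'a \<Rightarrow> bool" where
  "adjacent a b \<longleftrightarrow> cball b (5 * (\<epsilon> * d b)) \<subseteq> cball a (20 * (\<epsilon> * d a)) \<and> d b \<le> 2 * d a \<and> d a \<le> 2 * d b"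

section \<open>Distance to the boundary on the cells\<close>

lemma d_pos:
  assumes "x \<in> G"
  shows "0 < d x"
proof (rule infdist_pos_not_in_closed[OF frontier_closed frG])
  show "x \<notin> frontier G" using assms openG by (simp add: frontier_def interior_open)
qed

lemma d_lipschitz: "\<bar>d x - d y\<bar> \<le> dist x y"
  by (rule infdist_triangle_abs)

text \<open>A ball is connected: leaving \<open>G\<close>, it would meet the frontier closer to its
  centre than \<open>d x\<close>.\<close>

lemma ball_d_subset:
  assumes "x \<in> G"
  shows "ball x (d x) \<subseteq> G"
proof (rule ccontr)
  assume "\<not> ball x (d x) \<subseteq> G"
  hence "ball x (d x) \<inter> frontier G \<noteq> {}"
    using assms d_pos[OF assms] by (intro connected_Int_frontier) (force simp: disjoint_iff)+
  then obtain y where "y \<in> frontier G" "dist x y < d x" by auto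
  thus False using infdist_le[of y "frontier G" x] by simp
qed

lemma cball_subset_G:
  assumes "a \<in> G"
  shows "cball a (20 * (\<epsilon> * d a)) \<subseteq> G"
proof -
  have "20 * (\<epsilon> * d a) < d a" using eps d_pos[OF assms] by simp
  hence "cball a (20 * (\<epsilon> * d a)) \<subseteq> ball a (d a)" by auto
  thus ?thesis using ball_d_subset[OF assms] by blast
qed

text \<open>\<open>d\<close> is 1-Lipschitz and \<open>20 * \<epsilon> \<le> 1 / 5\<close>, so
  \<open>d\<close> varies by at most a fifth of \<open>d a\<close> on the enlarged ball.\<close>

lemma d_comparable:
  assumes "a \<in> G" "dist a x \<le> 20 * (\<epsilon> * d a)"
  shows "d a \<le> 2 * d x" "d x \<le> 2 * d a"
proof -
  have "20 * (\<epsilon> * d a) \<le> d a / 5" using eps d_pos[OF assms(1)] by simp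
  thus "d a \<le> 2 * d x" "d x \<le> 2 * d a"
    using d_lipschitz[of a x] assms d_pos[OF assms(1)] by linarith+
qed

text \<open>Consecutive curve samples \<open>x\<close>, \<open>y\<close> lie in balls around
  \<open>a\<close>, \<open>b\<close>, and the smallness of \<open>\<epsilon>\<close> makes the radii
  involved nearly equal. This turns a sampled curve into a walk on centres.\<close>

lemma adjacentI:
  assumes "a \<in> G" "b \<in> G" "dist a x \<le> 5 * (\<epsilon> * d a)" "dist b y \<le> 5 * (\<epsilon> * d b)" "dist x y \<le> \<epsilon> * d x"
  shows "adjacent a b"
proof -
  \<comment> \<open>In terms of \<open>p\<close>, \<open>q\<close>, \<open>w\<close> the estimates
    become linear; products with \<open>\<epsilon>\<close> are removed by
    \<open>100 * (\<epsilon> * t) \<le> t\<close>.\<close>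
  define p q w where "p = \<epsilon> * d a" and "q = \<epsilon> * d b" and "w = \<epsilon> * d x"
  have pq: "p > 0" "q > 0" "w \<ge> 0"
    unfolding p_def q_def w_def using eps d_pos assms(1,2) by (simp_all add: infdist_nonneg)
  have le: "100 * (\<epsilon> * t) \<le> t" if "t \<ge> 0" for t
    using mult_right_mono[OF eps(2) that] by simp
  have ax: "dist a x \<le> 5 * p" and by': "dist b y \<le> 5 * q" and xy: "dist x y \<le> w"
    using assms by (simp_all add: p_def q_def w_def)
  have lip: "d u \<le> d v + dist u v" "d v \<le> d u + dist u v" for u v
    using d_lipschitz[of u v] by linarith+
  have "\<epsilon> * d x \<le> \<epsilon> * (d a + 5 * p)"
    using lip(2)[where u=a and v=x] ax eps by (intro mult_left_mono) linarith+
  also have "\<dots> = p + \<epsilon> * (5 * p)" unfolding p_def by (rule distrib_left)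
  finally have w: "100 * w \<le> 105 * p" using le[of "5 * p"] pq unfolding w_def by linarith
  \<comment> \<open>\<open>e\<close> bounds the distance from \<open>a\<close> to \<open>b\<close>.
    The inequalities below give \<open>q < 1.2 * p\<close> and \<open>e + 5 * q < 18 * p\<close>, so
    the radius \<open>20 * p\<close> suffices.\<close>
  define e where "e = 5 * p + w + 5 * q"
  have e: "100 * (\<epsilon> * e) \<le> e" by (rule le) (use pq in \<open>simp add: e_def\<close>)
  have ab: "d b \<le> d a + e" "d a \<le> d b + e"
    using lip[where u=a and v=x] lip[where u=b and v=y] lip[where u=x and v=y] ax by' xy unfolding e_def by linarith+
  have "\<epsilon> * d b \<le> \<epsilon> * (d a + e)" using ab eps by (intro mult_left_mono) auto
  hence q: "100 * q \<le> 100 * p + e"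
    using e unfolding distrib_left p_def[symmetric] q_def[symmetric] by linarith
  have "\<epsilon> * d a \<le> \<epsilon> * (d b + e)" using ab eps by (intro mult_left_mono) auto
  hence q': "100 * p \<le> 100 * q + e"
    using e unfolding distrib_left p_def[symmetric] q_def[symmetric] by linarith
  have "p \<le> 2 * q" "q \<le> 2 * p" using q q' w pq unfolding e_def by linarith+
  hence "\<epsilon> * d a \<le> \<epsilon> * (2 * d b)" "\<epsilon> * d b \<le> \<epsilon> * (2 * d a)"
    unfolding p_def q_def mult.left_commute[of \<epsilon> 2] .
  hence "d a \<le> 2 * d b" "d b \<le> 2 * d a"
    using eps by (simp_all only: mult_le_cancel_left_pos)
  moreover have "cball b (5 * (\<epsilon> * d b)) \<subseteq> cball a (20 * (\<epsilon> * d a))"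
  proof
    fix z assume "z \<in> cball b (5 * (\<epsilon> * d b))"
    hence "dist b z \<le> 5 * q" by (simp add: q_def)
    moreover have "dist a b \<le> e"
      using ax by' xy dist_triangle[of a b x] dist_triangle[of x b y]
      unfolding e_def dist_commute[of y b] by linarith
    ultimately have "dist a z \<le> 20 * p"
      using dist_triangle[of a z b] q w pq unfolding e_def by linarith
    thus "z \<in> cball a (20 * (\<epsilon> * d a))" by (simp add: p_def)
  qed
  ultimately show ?thesis unfolding adjacent_def by (intro conjI)
qed

text \<open>Each curve sample is replaced by the centre of a cell containing it, which costs only
  constants because \<open>d\<close> is comparable there. The walk property quantifies over all
  \<open>f\<close> and \<open>g\<close>, so that chains and \<open>K\<close> are fixed before any
  function is considered.\<close>

lemma exists_chains:
  fixes s \<eta> \<beta> :: real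
  assumes s: "s > 1" and \<eta>: "\<eta> > 0" and \<beta>: "1 - (1 + \<eta>) / s \<le> \<beta>"
    and john: "s_john_domain s G"
  obtains C :: "'a \<Rightarrow> 'a set" and a0 :: 'a and K :: real where "K > 0"
    "\<And>a. a \<in> A \<Longrightarrow> finite (C a)" "\<And>a. a \<in> A \<Longrightarrow> a \<in> C a" "\<And>a. a \<in> A \<Longrightarrow> C a \<subseteq> A"
    "\<And>a. a \<in> A \<Longrightarrow> \<forall>(f :: 'a \<Rightarrow> real) g. (\<forall>r\<in>A. 0 \<le> g r) \<longrightarrow>
        (\<forall>r\<in>A. \<forall>t\<in>A. adjacent r t \<longrightarrow> \<bar>f r - f t\<bar> \<le> g r) \<longrightarrow> \<bar>f a - f a0\<bar> \<le> (\<Sum>r\<in>C a. g r)"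
    "\<And>a. a \<in> A \<Longrightarrow> (\<Sum>r\<in>C a. d r powr \<beta>) \<le> K * d a powr - \<eta>"
    "\<And>a r. a \<in> A \<Longrightarrow> r \<in> C a \<Longrightarrow> dist a r + d a \<le> K * d r powr (1 / s)"
proof -
  obtain x0 c where x0: "x0 \<in> G" and c: "c > 0" and curves: "\<forall>x\<in>G. \<exists>\<gamma> l.
        arclength_param \<gamma> l \<and> \<gamma> ` {0..l} \<subseteq> G \<and> \<gamma> 0 = x \<and> \<gamma> l = x0 \<and> l \<le> c \<and>
        (\<forall>t\<in>{0..l}. infdist (\<gamma> t) (frontier G) \<ge> t powr s / c)"
    using john unfolding s_john_domain_def by (elim conjE bexE exE)
  define b where "b = 1 - (1 + \<eta>) / s"
  define k where "k = min (1 / (c * 3 powr s)) (1 / (3 * (2 * D) powr (s - 1)))"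
  define K0 where "K0 = k powr (b - 1) * (2 powr (\<eta> + 1) / (\<eta> * \<epsilon>) + 1)"
  have Dpos: "D > 0" using d_pos[OF x0] D[OF x0] by linarith
  define P where "P a z N \<longleftrightarrow> z 0 = a \<and> z N = x0 \<and> (\<forall>i\<le>N. z i \<in> G) \<and>
           (\<forall>i<N. dist (z i) (z (Suc i)) \<le> \<epsilon> * d (z i)) \<and>
           (\<forall>i\<le>N. dist a (z i) \<le> (c * d (z i)) powr (1 / s)) \<and>
           (\<Sum>i\<le>N. d (z i) powr b) \<le> K0 * d a powr - \<eta>" for a z N
  have ex: "\<exists>zN. P a (fst zN) (snd zN)" if a: "a \<in> A" for a
  proof -
    have aG: "a \<in> G" using a AG by auto
    from bspec[OF curves aG] obtain \<gamma> l where \<gamma>: "arclength_param \<gamma> l" "\<gamma> ` {0..l} \<subseteq> G" "\<gamma> 0 = a"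
      "\<gamma> l = x0" "\<forall>t\<in>{0..l}. infdist (\<gamma> t) (frontier G) \<ge> t powr s / c" by (elim exE conjE)
    have "\<exists>z N. z 0 = \<gamma> 0 \<and> z N = \<gamma> l \<and> (\<forall>i\<le>N. z i \<in> \<gamma> ` {0..l}) \<and>
           (\<forall>i<N. dist (z i) (z (Suc i)) \<le> \<epsilon> * d (z i)) \<and>
           (\<forall>i\<le>N. dist (\<gamma> 0) (z i) \<le> (c * d (z i)) powr (1 / s)) \<and>
           (\<Sum>i\<le>N. d (z i) powr (1 - (1 + \<eta>) / s))
             \<le> min (1 / (c * 3 powr s)) (1 / (3 * (2 * D) powr (s - 1))) powr (1 - (1 + \<eta>) / s - 1) *
               (2 powr (\<eta> + 1) / (\<eta> * \<epsilon>) + 1) * d (\<gamma> 0) powr - \<eta>"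
    proof (rule john_chain[where d = d and \<gamma> = \<gamma> and l = l and c = c and s = s and D = D and \<epsilon> = \<epsilon> and \<eta> = \<eta>])
      show "dist (\<gamma> u) (\<gamma> v) \<le> v - u" if "0 \<le> u" "u \<le> v" "v \<le> l" for u v
        using arclength_param_dist_le[OF \<gamma>(1)] that by blast
      show "0 \<le> l" using \<gamma>(1) by (simp add: arclength_param_def)
      show "t powr s / c \<le> d (\<gamma> t)" if "0 \<le> t" "t \<le> l" for t
        using \<gamma>(5) that by simp
      show "0 < d (\<gamma> 0)" "d (\<gamma> 0) \<le> D" unfolding \<gamma>(3) by (fact d_pos[OF aG] D[OF aG])+
      show "\<epsilon> \<le> 1" using eps by simp
    qed (fact d_lipschitz c s \<eta> eps)+
    then obtain z N where z: "z 0 = \<gamma> 0" "z N = \<gamma> l" "\<forall>i\<le>N. z i \<in> \<gamma> ` {0..l}"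
           "\<forall>i<N. dist (z i) (z (Suc i)) \<le> \<epsilon> * d (z i)"
           "\<forall>i\<le>N. dist (\<gamma> 0) (z i) \<le> (c * d (z i)) powr (1 / s)"
           "(\<Sum>i\<le>N. d (z i) powr b) \<le> K0 * d (\<gamma> 0) powr - \<eta>"
      unfolding b_def K0_def k_def by (elim exE conjE)
    have "\<forall>i\<le>N. z i \<in> G" using z(3) \<gamma>(2) by blast
    hence "P a z N" using z unfolding P_def \<gamma>(3,4) by (intro conjI)
    thus ?thesis by (intro exI[of _ "(z, N)"]) simp
  qed
  have "\<forall>a\<in>A. \<exists>zN. P a (fst zN) (snd zN)" using ex by blast
  from bchoice[OF this] obtain w where w: "\<forall>a\<in>A. P a (fst (w a)) (snd (w a))" by blast
  define z N where "z a = fst (w a)" and "N a = snd (w a)" for a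
  have z: "\<And>a. a \<in> A \<Longrightarrow> z a 0 = a" "\<And>a. a \<in> A \<Longrightarrow> z a (N a) = x0"
    "\<And>a i. a \<in> A \<Longrightarrow> i \<le> N a \<Longrightarrow> z a i \<in> G"
    "\<And>a i. a \<in> A \<Longrightarrow> i < N a \<Longrightarrow> dist (z a i) (z a (Suc i)) \<le> \<epsilon> * d (z a i)"
    "\<And>a i. a \<in> A \<Longrightarrow> i \<le> N a \<Longrightarrow> dist a (z a i) \<le> (c * d (z a i)) powr (1 / s)"
    "\<And>a. a \<in> A \<Longrightarrow> (\<Sum>i\<le>N a. d (z a i) powr b) \<le> K0 * d a powr - \<eta>"
    using w unfolding P_def z_def N_def by blast+
  \<comment> \<open>A centre is sent to itself although enlarged balls of other centres may contain
    it; thus the chain of \<open>a\<close> starts at \<open>a\<close>.\<close>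
  define cell where "cell x = (if x \<in> A then x else SOME a. a \<in> A \<and> x \<in> cball a (5 * (\<epsilon> * d a)))" for x
  have cell: "cell x \<in> A \<and> dist (cell x) x \<le> 5 * (\<epsilon> * d (cell x))" if "x \<in> G" for x
  proof (cases "x \<in> A")
    case True
    thus ?thesis using d_pos[OF that] eps by (simp add: cell_def)
  next
    case False
    hence cx: "cell x = (SOME a. a \<in> A \<and> x \<in> cball a (5 * (\<epsilon> * d a)))" by (simp add: cell_def)
    have "\<exists>a. a \<in> A \<and> x \<in> cball a (5 * (\<epsilon> * d a))" using subsetD[OF cover that] by blast
    from someI_ex[OF this] show ?thesis unfolding cx by simp
  qed
  have cellG: "cell x \<in> G" if "x \<in> G" for x using cell[OF that] AG by auto
  have comp: "d (cell x) \<le> 2 * d x" "d x \<le> 2 * d (cell x)" if "x \<in> G" for x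
  proof -
    have "0 < \<epsilon> * d (cell x)" using eps d_pos[OF cellG[OF that]] by simp
    hence "dist (cell x) x \<le> 20 * (\<epsilon> * d (cell x))"
      using cell[OF that] by linarith
    from d_comparable[OF cellG[OF that] this] show "d (cell x) \<le> 2 * d x" "d x \<le> 2 * d (cell x)" .
  qed
  define C where "C a = (\<lambda>i. cell (z a i)) ` {..N a}" for a
  \<comment> \<open>\<open>2 powr \<bar>b\<bar>\<close> compares \<open>d\<close> at a sample and at
    its centre for either sign of \<open>b\<close>; \<open>D powr (\<beta> - b)\<close> passes from
    the exponent \<open>b\<close> to \<open>\<beta> \<ge> b\<close>.\<close>
  define K1 where "K1 = D powr (\<beta> - b) * (2 powr \<bar>b\<bar> * K0)"
  define K2 where "K2 = 2 * ((2 * c) powr (1 / s)) + 3 * D powr (1 - 1 / s)"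
  define K where "K = max 1 (max K1 K2)"
  show ?thesis
  proof (rule that[of K C "cell x0"])
    show "K > 0" by (simp add: K_def)
    fix a assume a: "a \<in> A"
    show "finite (C a)" by (simp add: C_def)
    show "a \<in> C a" unfolding C_def
      using a z(1)[OF a] by (intro image_eqI[of _ _ 0]) (auto simp: cell_def)
    show "C a \<subseteq> A" using a z(3) cell by (auto simp: C_def)
    show "(\<Sum>r\<in>C a. d r powr \<beta>) \<le> K * d a powr - \<eta>"
    proof -
      \<comment> \<open>Several samples may share a centre; the nonnegative repetitions only enlarge
        the sum over indices.\<close>
      have "(\<Sum>r\<in>C a. d r powr \<beta>) \<le> (\<Sum>i\<le>N a. d (cell (z a i)) powr \<beta>)"
        unfolding C_def by (rule order.trans[OF sum_image_le]) auto
      also have "\<dots> \<le> (\<Sum>i\<le>N a. D powr (\<beta> - b) * (2 powr \<bar>b\<bar> * d (z a i) powr b))"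
      proof (rule sum_mono)
        fix i assume "i \<in> {..N a}"
        hence zG: "z a i \<in> G" using z(3) a by auto
        let ?r = "cell (z a i)"
        have r: "0 < d ?r" "d ?r \<le> D" using cellG[OF zG] d_pos D by auto
        have "d ?r powr \<beta> = d ?r powr (\<beta> - b) * d ?r powr b"
          by (simp add: powr_add[symmetric])
        also have "\<dots> \<le> D powr (\<beta> - b) * (2 powr \<bar>b\<bar> * d (z a i) powr b)"
        proof (intro mult_mono)
          show "d ?r powr (\<beta> - b) \<le> D powr (\<beta> - b)"
            using r \<beta> by (intro powr_mono2) (auto simp: b_def)
          show "d ?r powr b \<le> 2 powr \<bar>b\<bar> * d (z a i) powr b"
          proof (cases "b \<ge> 0")
            case True
            have "d ?r powr b \<le> (2 * d (z a i)) powr b"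
              using True comp[OF zG] r by (intro powr_mono2) auto
            thus ?thesis using True by (simp add: powr_mult)
          next
            case False
            have "d ?r powr b \<le> (d (z a i) / 2) powr b"
              using False comp[OF zG] r d_pos[OF zG] by (intro powr_mono2') auto
            thus ?thesis using False by (simp add: powr_divide powr_minus_divide)
          qed
        qed auto
        finally show "d ?r powr \<beta> \<le> D powr (\<beta> - b) * (2 powr \<bar>b\<bar> * d (z a i) powr b)" .
      qed
      also have "\<dots> = D powr (\<beta> - b) * (2 powr \<bar>b\<bar> * (\<Sum>i\<le>N a. d (z a i) powr b))"
        by (simp add: sum_distrib_left)
      also have "\<dots> \<le> D powr (\<beta> - b) * (2 powr \<bar>b\<bar> * (K0 * d a powr - \<eta>))"
        using z(6)[OF a] by (intro mult_left_mono) auto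
      also have "\<dots> = K1 * d a powr - \<eta>" by (simp add: K1_def)
      also have "\<dots> \<le> K * d a powr - \<eta>" by (intro mult_right_mono) (auto simp: K_def)
      finally show ?thesis .
    qed
    show "\<forall>(f :: 'a \<Rightarrow> real) g. (\<forall>r\<in>A. 0 \<le> g r) \<longrightarrow>
        (\<forall>r\<in>A. \<forall>t\<in>A. adjacent r t \<longrightarrow> \<bar>f r - f t\<bar> \<le> g r) \<longrightarrow> \<bar>f a - f (cell x0)\<bar> \<le> (\<Sum>r\<in>C a. g r)"
    proof (intro allI impI)
      fix f g :: "'a \<Rightarrow> real"
      assume g: "\<forall>r\<in>A. 0 \<le> g r" and fg: "\<forall>r\<in>A. \<forall>t\<in>A. adjacent r t \<longrightarrow> \<bar>f r - f t\<bar> \<le> g r"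
      have "\<bar>f (cell (z a 0)) - f (cell (z a (N a)))\<bar> \<le> (\<Sum>r\<in>(\<lambda>i. cell (z a i)) ` {..N a}. g r)"
      proof (rule walk_sum[where v = "\<lambda>i. cell (z a i)" and f = f and g = g])
        fix i assume i: "i < N a"
        have zi: "z a i \<in> G" "z a (Suc i) \<in> G" using z(3)[OF a] i by auto
        have "adjacent (cell (z a i)) (cell (z a (Suc i)))"
          by (rule adjacentI[where x="z a i" and y="z a (Suc i)"]) (use zi cell z(4)[OF a i] cellG in auto)
        thus "\<bar>f (cell (z a i)) - f (cell (z a (Suc i)))\<bar> \<le> g (cell (z a i))"
          using fg cell zi by blast
      qed (use g cell z(3)[OF a] in auto)
      moreover have "cell (z a 0) = a" using z(1)[OF a] a by (simp add: cell_def)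
      ultimately show "\<bar>f a - f (cell x0)\<bar> \<le> (\<Sum>r\<in>C a. g r)"
        using z(2)[OF a] by (simp add: C_def)
    qed
    fix r assume "r \<in> C a"
    then obtain i where i: "i \<le> N a" "r = cell (z a i)" by (auto simp: C_def)
    have zG: "z a i \<in> G" using z(3)[OF a] i by auto
    have r: "0 < d r" "d r \<le> D" using cellG[OF zG] d_pos D i by auto
    have 1: "dist a (z a i) \<le> (2 * c) powr (1 / s) * d r powr (1 / s)"
    proof -
      have "dist a (z a i) \<le> (c * d (z a i)) powr (1 / s)" using z(5)[OF a i(1)] .
      also have "\<dots> \<le> (2 * c * d r) powr (1 / s)"
        using comp(2)[OF zG] c s d_pos[OF zG] by (intro powr_mono2) (auto simp: i(2))
      also have "\<dots> = (2 * c) powr (1 / s) * d r powr (1 / s)"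
        using c r by (simp add: powr_mult)
      finally show ?thesis .
    qed
    \<comment> \<open>Boundedness of \<open>d\<close> and \<open>s > 1\<close> allow linear terms in
      \<open>d r\<close> to be absorbed into the power \<open>1 / s\<close>.\<close>
    have 2: "d r \<le> D powr (1 - 1 / s) * d r powr (1 / s)"
    proof -
      have "d r = d r powr (1 - 1 / s) * d r powr (1 / s)"
        using r by (simp add: powr_add[symmetric])
      also have "\<dots> \<le> D powr (1 - 1 / s) * d r powr (1 / s)"
        using r s by (intro mult_right_mono powr_mono2) auto
      finally show ?thesis .
    qed
    have "dist r (z a i) \<le> 5 * (\<epsilon> * d r)" using cell[OF zG] i by simp
    also have "\<dots> \<le> d r" using eps r by simp
    finally have 3: "dist r (z a i) \<le> d r" .
    have "dist a r \<le> dist a (z a i) + d r"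
      using 3 dist_triangle[of a r "z a i"] by (simp add: dist_commute)
    moreover have "d a \<le> dist a (z a i) + 2 * d r"
      using d_lipschitz[of a "z a i"] comp(2)[OF zG] i by simp
    ultimately have "dist a r + d a \<le> 2 * dist a (z a i) + 3 * d r" by simp
    also have "\<dots> \<le> 2 * ((2 * c) powr (1 / s) * d r powr (1 / s)) + 3 * (D powr (1 - 1 / s) * d r powr (1 / s))"
      using 1 2 by (intro add_mono mult_left_mono) auto
    also have "\<dots> = K2 * d r powr (1 / s)" by (simp add: K2_def algebra_simps)
    also have "\<dots> \<le> K * d r powr (1 / s)" by (intro mult_right_mono) (auto simp: K_def)
    finally show "dist a r + d a \<le> K * d r powr (1 / s)" .
  qed
qed

end

section \<open>Minkowski content and sums over the cover\<close>

lemma set_plus_ball_eq: "E + ball 0 r = (\<Union>x\<in>E. ball x r)" for E :: "'a::real_normed_vector set"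
proof (intro equalityI subsetI)
  fix y assume "y \<in> E + ball 0 r"
  then obtain x b where xb: "x \<in> E" "norm b < r" "y = x + b" by (auto simp: set_plus_def)
  hence "y \<in> ball x r" by (simp add: dist_norm)
  thus "y \<in> (\<Union>x\<in>E. ball x r)" using xb by blast
next
  fix y assume "y \<in> (\<Union>x\<in>E. ball x r)"
  then obtain x where x: "x \<in> E" "dist x y < r" by auto
  have "y = x + (y - x)" "y - x \<in> ball 0 r" using x by (auto simp: dist_norm norm_minus_commute)
  thus "y \<in> E + ball 0 r" unfolding set_plus_def using x by blast
qed

lemma open_set_plus_ball: "open (E + ball 0 r)" for E :: "'a::real_normed_vector set"
  unfolding set_plus_ball_eq by (intro open_UN) auto

lemma set_plus_ball_mono: "r \<le> r' \<Longrightarrow> E + ball 0 r \<subseteq> E + ball 0 r'" for E :: "'a::real_normed_vector set"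
  by (intro set_plus_mono2) auto

lemma bounded_set_plus_ball:
  fixes E :: "'a::real_normed_vector set"
  assumes "bounded E"
  shows "bounded (E + ball 0 r)"
proof -
  have "E + ball 0 r = (\<Union>x\<in>E. \<Union>y\<in>ball 0 r. {x + y})" by (auto simp: set_plus_def)
  thus ?thesis using bounded_sums[OF assms bounded_ball[of 0 r]] by simp
qed

lemma emeasure_set_plus_ball_finite:
  fixes E :: "'a::euclidean_space set"
  assumes "bounded E"
  shows "emeasure lebesgue (E + ball 0 r) < \<infinity>"
proof -
  have "emeasure lebesgue (E + ball 0 r) = emeasure lborel (E + ball 0 r)"
    using open_set_plus_ball[of E r] by simp
  thus ?thesis using emeasure_bounded_finite[OF bounded_set_plus_ball[OF assms, of r]] by simp
qed

text \<open>An exponent above the dimension lies outside the set whose supremum is taken, so its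
  limsup is finite; this controls small radii. Radii between \<open>r0\<close> and \<open>R\<close>
  are handled by the measure of the largest neighbourhood.\<close>

lemma minkowski_content_bound:
  fixes E :: "'a::euclidean_space set"
  assumes E: "bounded E" and dim: "minkowski_dim E \<le> lam" and mu: "lam < \<mu>" "0 \<le> \<mu>" "\<mu> \<le> real DIM('a)"
  obtains C where "C \<ge> 0" "\<And>r. 0 < r \<Longrightarrow> r \<le> R \<Longrightarrow>
      emeasure lebesgue (E + ball 0 r) \<le> ennreal (C * r powr (real DIM('a) - \<mu>))"
proof -
  define n where "n = real DIM('a)"
  define f where "f = (\<lambda>l r. emeasure lebesgue (E + ball 0 r) * ennreal (r powr (l - n)))"
  define S where "S = {l. l \<ge> 0 \<and> Limsup (at_right 0) (f l) = \<infinity>}"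
  \<comment> \<open>For \<open>l > n\<close> the factor \<open>r powr (l - n)\<close> is at most 1
    for small \<open>r\<close>, so the limsup is bounded by the measure of one fixed
    neighbourhood.\<close>
  have "l \<le> n" if "l \<in> S" for l
  proof (rule ccontr)
    assume l: "\<not> l \<le> n"
    have "Limsup (at_right 0) (f l) \<le> emeasure lebesgue (E + ball 0 1)"
    proof (rule Limsup_bounded)
      have "eventually (\<lambda>r::real. 0 < r \<and> r \<le> 1) (at_right 0)"
        unfolding eventually_at_right_field by (intro exI[of _ 1]) auto
      thus "\<forall>\<^sub>F r in at_right 0. f l r \<le> emeasure lebesgue (E + ball 0 1)"
      proof eventually_elim
        case (elim r)
        have "f l r \<le> emeasure lebesgue (E + ball 0 1) * ennreal 1"
          unfolding f_def
        proof (intro mult_mono emeasure_mono ennreal_leI set_plus_ball_mono)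
          show "r powr (l - n) \<le> 1" using elim l by (intro powr_le1) auto
          show "E + ball 0 1 \<in> sets lebesgue" using open_set_plus_ball[of E 1] by auto
        qed (use elim in auto)
        thus ?case by simp
      qed
    qed
    also have "\<dots> < \<infinity>" by (rule emeasure_set_plus_ball_finite[OF E])
    finally show False using that by (simp add: S_def)
  qed
  hence bdd: "bdd_above S" by (rule bdd_aboveI)
  \<comment> \<open>The supremum is meaningful only because \<open>S\<close> is bounded above; on an unbounded set \<open>Sup\<close> would be junk.\<close>
  have "minkowski_dim E = Sup S" by (simp add: minkowski_dim_def S_def f_def n_def)
  hence "\<mu> \<notin> S" using cSup_upper[OF _ bdd, of \<mu>] dim mu by linarith
  hence "Limsup (at_right 0) (f \<mu>) < \<infinity>" using mu by (simp add: S_def less_top)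
  then obtain L where L: "Limsup (at_right 0) (f \<mu>) < ennreal L" "L \<ge> 0"
    by (metis ennreal_Ex_less_of_nat infinity_ennreal_def ennreal_of_nat_eq_real_of_nat of_nat_0_le_iff)
  from Limsup_lessD[OF L(1)] obtain r0 where r0: "r0 > 0" "\<And>r. 0 < r \<Longrightarrow> r < r0 \<Longrightarrow> f \<mu> r < ennreal L"
    unfolding eventually_at_right_field by auto
  define M where "M = measure lebesgue (E + ball 0 R)"
  have M: "emeasure lebesgue (E + ball 0 R) = ennreal M"
    unfolding M_def using emeasure_set_plus_ball_finite[OF E, of R] by (intro emeasure_eq_ennreal_measure) auto
  \<comment> \<open>The second entry serves \<open>r \<ge> r0\<close>, where
    \<open>r powr (n - \<mu>) \<ge> r0 powr (n - \<mu>)\<close> because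
    \<open>\<mu> \<le> n\<close>.\<close>
  define C where "C = max L (M * r0 powr (\<mu> - n))"
  show ?thesis
  proof (rule that[of C])
    show "C \<ge> 0" using L by (simp add: C_def)
    fix r :: real assume r: "0 < r" "r \<le> R"
    show "emeasure lebesgue (E + ball 0 r) \<le> ennreal (C * r powr (real DIM('a) - \<mu>))"
    proof (cases "r < r0")
      case True
      have 1: "ennreal (r powr (\<mu> - n)) * ennreal (r powr (n - \<mu>)) = 1"
        using r by (simp add: ennreal_mult[symmetric] powr_add[symmetric])
      have "emeasure lebesgue (E + ball 0 r) = f \<mu> r * ennreal (r powr (n - \<mu>))"
        unfolding f_def mult.assoc 1 by simp
      also have "\<dots> \<le> ennreal L * ennreal (r powr (n - \<mu>))"
        using r0(2)[OF r(1) True] by (intro mult_right_mono) auto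
      also have "\<dots> = ennreal (L * r powr (n - \<mu>))" using L by (simp add: ennreal_mult)
      also have "\<dots> \<le> ennreal (C * r powr (n - \<mu>))"
        by (intro ennreal_leI mult_right_mono) (auto simp: C_def)
      finally show ?thesis by (simp add: n_def)
    next
      case False
      have "emeasure lebesgue (E + ball 0 r) \<le> ennreal M"
        unfolding M[symmetric] using r open_set_plus_ball[of E R]
        by (intro emeasure_mono set_plus_ball_mono) auto
      also have "\<dots> \<le> ennreal (C * r powr (n - \<mu>))"
      proof (rule ennreal_leI)
        have "M = M * r0 powr (\<mu> - n) * r0 powr (n - \<mu>)"
          using r0 by (simp add: powr_add[symmetric] mult.assoc)
        also have "\<dots> \<le> C * r powr (n - \<mu>)"
          using False r0 mu by (intro mult_mono powr_mono2) (auto simp: C_def n_def M_def intro!: max.coboundedI2)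
        finally show "M \<le> C * r powr (n - \<mu>)" .
      qed
      finally show ?thesis by (simp add: n_def)
    qed
  qed
qed

lemma frontier_nonempty:
  fixes G :: "'a::euclidean_space set"
  assumes "bounded G" "G \<noteq> {}"
  shows "frontier G \<noteq> {}"
  using assms frontier_eq_empty[of G] not_bounded_UNIV by auto

text \<open>Vitali's lemma requires bounded radii; the bound \<open>D\<close> comes from measuring
  distances to one fixed frontier point.\<close>

lemma whitney_cover_exists:
  fixes G :: "'a::euclidean_space set"
  assumes G: "open G" "bounded G" "G \<noteq> {}" and \<epsilon>: "0 < \<epsilon>" "\<epsilon> \<le> 1 / 100"
  obtains A D where "whitney_cover G A \<epsilon> D"
proof -
  have fr: "frontier G \<noteq> {}" using frontier_nonempty G by auto
  then obtain b where b: "b \<in> frontier G" by auto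
  from G(2) obtain D where D: "\<And>x. x \<in> G \<Longrightarrow> dist b x \<le> D"
    unfolding bounded_any_center[of G b] by blast
  have D': "infdist x (frontier G) \<le> D" if "x \<in> G" for x
    using infdist_le[OF b, of x] D[OF that] by (simp add: dist_commute)
  have pos: "0 < infdist x (frontier G)" if "x \<in> G" for x
    using G(1) that by (intro infdist_pos_not_in_closed[OF frontier_closed fr])
      (simp add: frontier_def interior_open)
  obtain A where A: "countable A" "A \<subseteq> G"
     "pairwise (\<lambda>i j. disjnt (cball i (\<epsilon> * infdist i (frontier G))) (cball j (\<epsilon> * infdist j (frontier G)))) A"
     "G \<subseteq> (\<Union>i\<in>A. cball i (5 * (\<epsilon> * infdist i (frontier G))))"
  proof (rule Vitali_covering_lemma_cballs[where S = G and K = G and a = "\<lambda>x. x" and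
        r = "\<lambda>x. \<epsilon> * infdist x (frontier G)" and B = "\<epsilon> * D"])
    show "G \<subseteq> (\<Union>i\<in>G. cball i (\<epsilon> * infdist i (frontier G)))"
      using \<epsilon> by (auto simp: infdist_nonneg intro!: bexI)
    show "0 < \<epsilon> * infdist i (frontier G) \<and> \<epsilon> * infdist i (frontier G) \<le> \<epsilon> * D" if "i \<in> G" for i
      using pos[OF that] D'[OF that] \<epsilon> by (simp add: mult_left_mono)
  qed
  have "whitney_cover G A \<epsilon> D"
  proof
    show "disjoint_family_on (\<lambda>a. cball a (\<epsilon> * infdist a (frontier G))) A"
      using A(3) unfolding disjoint_family_on_def pairwise_def disjnt_def by blast
  qed (use G A \<epsilon> fr D' in blast)+
  thus ?thesis by (rule that)
qed

lemma unit_ball_vol_neq_0: "unit_ball_vol (real m) \<noteq> 0"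
  using unit_ball_vol_pos[of "real m"] by linarith

section \<open>Packing estimates for the cover\<close>

context whitney_cover
begin

lemma sum_small_balls_le:
  assumes "B \<subseteq> A" "S \<in> sets borel" "\<And>a. a \<in> B \<Longrightarrow> cball a (\<epsilon> * d a) \<subseteq> S"
  shows "(\<integral>\<^sup>+a. ennreal (unit_ball_vol DIM('a) * (\<epsilon> * d a) ^ DIM('a)) \<partial>count_space B) \<le> emeasure lborel S"
proof -
  have "(\<integral>\<^sup>+a. ennreal (unit_ball_vol DIM('a) * (\<epsilon> * d a) ^ DIM('a)) \<partial>count_space B) =
        (\<integral>\<^sup>+a. emeasure lborel (cball a (\<epsilon> * d a)) \<partial>count_space B)"
    using eps by (intro nn_integral_cong) (simp add: emeasure_cball infdist_nonneg)
  also have "\<dots> = emeasure lborel (\<Union>a\<in>B. cball a (\<epsilon> * d a))"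
    using assms cA disj
    by (intro emeasure_UN_countable[symmetric]) (auto intro: countable_subset disjoint_family_on_mono)
  also have "\<dots> \<le> emeasure lborel S"
    using assms by (intro emeasure_mono UN_least) auto
  finally show ?thesis .
qed

text \<open>The disjoint balls in \<open>S\<close> have volumes proportional to
  \<open>d a ^ DIM('a)\<close>, so the volume of \<open>S\<close> limits the sum of these
  powers.\<close>

lemma sum_d_power_le:
  assumes "B \<subseteq> A" "S \<in> sets borel" "\<And>a. a \<in> B \<Longrightarrow> cball a (\<epsilon> * d a) \<subseteq> S"
    and "emeasure lborel S \<le> ennreal m" "m \<ge> 0"
  shows "(\<integral>\<^sup>+a. ennreal (d a ^ DIM('a)) \<partial>count_space B) \<le> ennreal (m / (unit_ball_vol DIM('a) * \<epsilon> ^ DIM('a)))"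
proof -
  have *: "unit_ball_vol DIM('a) * \<epsilon> ^ DIM('a) > 0" using eps by simp
  have "(\<integral>\<^sup>+a. ennreal (d a ^ DIM('a)) \<partial>count_space B) =
     (\<integral>\<^sup>+a. ennreal (1 / (unit_ball_vol DIM('a) * \<epsilon> ^ DIM('a))) * ennreal (unit_ball_vol DIM('a) * (\<epsilon> * d a) ^ DIM('a)) \<partial>count_space B)"
    using * eps by (intro nn_integral_cong) (simp add: unit_ball_vol_neq_0 ennreal_mult[symmetric] infdist_nonneg power_mult_distrib)
  also have "\<dots> = ennreal (1 / (unit_ball_vol DIM('a) * \<epsilon> ^ DIM('a))) * (\<integral>\<^sup>+a. ennreal (unit_ball_vol DIM('a) * (\<epsilon> * d a) ^ DIM('a)) \<partial>count_space B)"
    by (intro nn_integral_cmult) auto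
  also have "\<dots> \<le> ennreal (1 / (unit_ball_vol DIM('a) * \<epsilon> ^ DIM('a))) * ennreal m"
    using sum_small_balls_le[OF assms(1-3)] assms(4) by (intro mult_left_mono) (auto intro: order.trans)
  also have "\<dots> = ennreal (m / (unit_ball_vol DIM('a) * \<epsilon> ^ DIM('a)))"
    using * assms(5) by (subst ennreal_mult[symmetric]) (auto simp: less_imp_le)
  finally show ?thesis .
qed

lemma nn_integral_count_space_restrict:
  "(\<integral>\<^sup>+a. f a * indicator {a. P a} a \<partial>count_space A) = (\<integral>\<^sup>+a. f a \<partial>count_space {a\<in>A. P a})"
proof -
  have "(\<integral>\<^sup>+a. f a * indicator {a. P a} a \<partial>count_space A) =
    (\<integral>\<^sup>+a. f a * indicator {a\<in>A. P a} a \<partial>count_space A)"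
    by (intro nn_integral_cong) (auto simp: indicator_def)
  also have "\<dots> = (\<integral>\<^sup>+a. f a \<partial>restrict_space (count_space A) {a\<in>A. P a})"
    by (intro nn_integral_restrict_space[symmetric]) auto
  also have "restrict_space (count_space A) {a\<in>A. P a} = count_space {a\<in>A. P a}"
    by (subst restrict_count_space) (auto intro: arg_cong[where f=count_space])
  finally show ?thesis .
qed

text \<open>The centres whose chain passes through \<open>r\<close>, together with their small
  balls, lie in \<open>cball r R\<close> with \<open>R\<close> of order
  \<open>d r powr (1 / s)\<close>; packing does the rest.\<close>

lemma shadow_bound:
  assumes K: "K > 0" and s: "s > 0" and r: "r \<in> A"
    and chain: "\<And>a. a \<in> A \<Longrightarrow> r \<in> C a \<Longrightarrow> dist a r + d a \<le> K * d r powr (1 / s)"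
  shows "(\<integral>\<^sup>+a. ennreal (d a ^ DIM('a)) * indicator {a. r \<in> C a} a \<partial>count_space A)
           \<le> ennreal ((K / \<epsilon>) ^ DIM('a) * d r powr (real DIM('a) / s))"
proof -
  define R where "R = K * d r powr (1 / s)"
  have R: "R \<ge> 0" using K by (simp add: R_def)
  have rp: "d r > 0" using d_pos r AG by auto
  have "(\<integral>\<^sup>+a. ennreal (d a ^ DIM('a)) * indicator {a. r \<in> C a} a \<partial>count_space A) =
    (\<integral>\<^sup>+a. ennreal (d a ^ DIM('a)) \<partial>count_space {a\<in>A. r \<in> C a})"
    by (rule nn_integral_count_space_restrict)
  also have "\<dots> \<le> ennreal ((unit_ball_vol DIM('a) * R ^ DIM('a)) / (unit_ball_vol DIM('a) * \<epsilon> ^ DIM('a)))"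
  proof (rule sum_d_power_le[where S = "cball r R"])
    fix a assume a: "a \<in> {a\<in>A. r \<in> C a}"
    have "\<epsilon> * d a \<le> d a" using eps d_pos[of a] a AG by auto
    hence "dist a r + \<epsilon> * d a \<le> R" using chain[of a] a by (auto simp: R_def)
    thus "cball a (\<epsilon> * d a) \<subseteq> cball r R"
      by (intro subsetI) (simp add: dist_commute, metis add_left_mono dist_commute dist_triangle order.trans)
  next
    show "emeasure lborel (cball r R) \<le> ennreal (unit_ball_vol DIM('a) * R ^ DIM('a))"
      using emeasure_cball[OF R, of r] by simp
  qed (use R in \<open>auto simp: less_imp_le\<close>)
  also have "(unit_ball_vol DIM('a) * R ^ DIM('a)) / (unit_ball_vol DIM('a) * \<epsilon> ^ DIM('a)) = (K / \<epsilon>) ^ DIM('a) * (d r powr (1 / s)) ^ DIM('a)"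
    by (simp add: unit_ball_vol_neq_0 R_def power_mult_distrib power_divide)
  also have "(d r powr (1 / s)) ^ DIM('a) = d r powr (real DIM('a) / s)"
    using rp by (simp add: powr_power)
  finally show ?thesis .
qed

text \<open>If \<open>x\<close> lies in the enlarged balls of several centres, their disjoint small
  balls have radii comparable to \<open>\<epsilon> * d x\<close> and all lie in
  \<open>cball x (d x)\<close>, so only boundedly many fit.\<close>

lemma overlap_bound:
  "(\<integral>\<^sup>+a. indicator (cball a (20 * (\<epsilon> * d a))) x \<partial>count_space A) \<le> ennreal ((2 / \<epsilon>) ^ DIM('a)) * indicator G x"
proof (cases "x \<in> G")
  case False
  have "(\<integral>\<^sup>+a. indicator (cball a (20 * (\<epsilon> * d a))) x \<partial>count_space A) = (\<integral>\<^sup>+a. 0 \<partial>count_space A)"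
  proof (rule nn_integral_cong)
    fix a assume "a \<in> space (count_space A)"
    hence "a \<in> G" using AG by auto
    hence "x \<notin> cball a (20 * (\<epsilon> * d a))" using cball_subset_G[of a] False by blast
    thus "indicator (cball a (20 * (\<epsilon> * d a))) x = (0::ennreal)" by simp
  qed
  thus ?thesis by simp
next
  case True
  have dx: "d x > 0" by (rule d_pos[OF True])
  define B where "B = {a\<in>A. x \<in> cball a (20 * (\<epsilon> * d a))}"
  have comp: "d a \<le> 2 * d x" "d x \<le> 2 * d a" "cball a (\<epsilon> * d a) \<subseteq> cball x (d x)" if "a \<in> B" for a
  proof -
    have aG: "a \<in> G" and ax: "dist a x \<le> 20 * (\<epsilon> * d a)" using that AG by (auto simp: B_def)
    show le: "d a \<le> 2 * d x" "d x \<le> 2 * d a" using d_comparable[OF aG ax] by (simp_all only:)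
    have "\<epsilon> * d a \<le> d a / 100" using mult_right_mono[OF eps(2), of "d a"] by (simp add: infdist_nonneg)
    hence *: "dist a x + \<epsilon> * d a \<le> d x" using ax le(1) dx by linarith
    show "cball a (\<epsilon> * d a) \<subseteq> cball x (d x)"
    proof
      fix y assume "y \<in> cball a (\<epsilon> * d a)"
      hence "dist a y \<le> \<epsilon> * d a" by simp
      hence "dist x y \<le> d x" using * dist_triangle[of x y a] dist_commute[of x a] by linarith
      thus "y \<in> cball x (d x)" by simp
    qed
  qed
  have "(\<integral>\<^sup>+a. indicator (cball a (20 * (\<epsilon> * d a))) x \<partial>count_space A) =
        (\<integral>\<^sup>+a. 1 * indicator {a. x \<in> cball a (20 * (\<epsilon> * d a))} a \<partial>count_space A)"
    by (intro nn_integral_cong) (auto simp: indicator_def)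
  also have "\<dots> = (\<integral>\<^sup>+a. 1 \<partial>count_space B)"
    unfolding B_def by (rule nn_integral_count_space_restrict)
  \<comment> \<open>The weight \<open>(2 * d a / d x) ^ DIM('a)\<close> is at least 1 on
    \<open>B\<close>, which turns counting into a sum bounded by packing.\<close>
  also have "\<dots> \<le> (\<integral>\<^sup>+a. ennreal ((2 / d x) ^ DIM('a)) * ennreal (d a ^ DIM('a)) \<partial>count_space B)"
  proof (rule nn_integral_mono)
    fix a assume "a \<in> space (count_space B)"
    hence a: "a \<in> B" by simp
    have "1 \<le> (2 / d x) ^ DIM('a) * d a ^ DIM('a)"
      unfolding power_mult_distrib[symmetric]
      using comp(2)[OF a] dx by (intro one_le_power) (simp add: field_simps)
    thus "1 \<le> ennreal ((2 / d x) ^ DIM('a)) * ennreal (d a ^ DIM('a))"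
      using dx by (simp add: ennreal_mult[symmetric] infdist_nonneg)
  qed
  also have "\<dots> = ennreal ((2 / d x) ^ DIM('a)) * (\<integral>\<^sup>+a. ennreal (d a ^ DIM('a)) \<partial>count_space B)"
    by (rule nn_integral_cmult) auto
  also have "\<dots> \<le> ennreal ((2 / d x) ^ DIM('a)) * ennreal ((unit_ball_vol DIM('a) * d x ^ DIM('a)) / (unit_ball_vol DIM('a) * \<epsilon> ^ DIM('a)))"
  proof (intro mult_left_mono sum_d_power_le[where S = "cball x (d x)"])
    show "emeasure lborel (cball x (d x)) \<le> ennreal (unit_ball_vol DIM('a) * d x ^ DIM('a))"
      using emeasure_cball[of "d x" x] dx by simp
  qed (use comp(3) dx in \<open>auto simp: less_imp_le B_def\<close>)
  also have "\<dots> = ennreal ((2 / d x) ^ DIM('a) * ((unit_ball_vol DIM('a) * d x ^ DIM('a)) / (unit_ball_vol DIM('a) * \<epsilon> ^ DIM('a))))"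
    using dx eps by (intro ennreal_mult[symmetric]) (auto simp: less_imp_le)
  also have "(2 / d x) ^ DIM('a) * ((unit_ball_vol DIM('a) * d x ^ DIM('a)) / (unit_ball_vol DIM('a) * \<epsilon> ^ DIM('a))) = (2 / \<epsilon>) ^ DIM('a)"
    using dx by (simp add: unit_ball_vol_neq_0 power_divide)
  finally show ?thesis using True by simp
qed

text \<open>Dyadic layers: centres with \<open>d a \<le> \<rho> j\<close> have their small balls in
  the \<open>2 * \<rho> j\<close>-neighbourhood of the frontier, whose volume is of order at most
  \<open>\<rho> j powr (n - \<mu>)\<close>. Weighted by \<open>\<rho> (Suc j) powr - \<eta>\<close>,
  the layers give a geometric series, convergent since \<open>\<eta> < n - \<mu>\<close>.\<close>

lemma sum_d_finite:
  assumes dim: "minkowski_dim (frontier G) \<le> lam" and \<eta>: "0 < \<eta>" "\<eta> < real DIM('a) - \<mu>" and \<mu>: "lam < \<mu>" "0 \<le> \<mu>"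
    and D0: "D > 0"
  shows "(\<integral>\<^sup>+a. ennreal (d a ^ DIM('a) * d a powr - \<eta>) \<partial>count_space A) < \<infinity>"
proof -
  define n where "n = real DIM('a)"
  have "bounded (frontier G)" using compact_frontier_bounded[OF bndG] by (rule compact_imp_bounded)
  then obtain C where C: "C \<ge> 0" "\<And>r. 0 < r \<Longrightarrow> r \<le> 2 * D \<Longrightarrow>
      emeasure lebesgue (frontier G + ball 0 r) \<le> ennreal (C * r powr (n - \<mu>))"
    using minkowski_content_bound[OF _ dim \<mu>, of "2 * D"] \<eta> unfolding n_def by auto
  define \<rho> where "\<rho> j = D / 2 ^ j" for j :: nat
  have \<rho>: "\<rho> j > 0" "\<rho> j \<le> D" for j using D0 by (auto simp: \<rho>_def field_simps)
  define c where "c = C * 2 powr (n - \<mu>) / (unit_ball_vol DIM('a) * \<epsilon> ^ DIM('a))"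
  have c: "c \<ge> 0" using C eps by (simp add: c_def less_imp_le)
  have layer: "(\<integral>\<^sup>+a. ennreal (d a ^ DIM('a)) * indicator {a. d a \<le> \<rho> j} a \<partial>count_space A)
      \<le> ennreal (c * \<rho> j powr (n - \<mu>))" for j
  proof -
    have "(\<integral>\<^sup>+a. ennreal (d a ^ DIM('a)) * indicator {a. d a \<le> \<rho> j} a \<partial>count_space A) =
      (\<integral>\<^sup>+a. ennreal (d a ^ DIM('a)) \<partial>count_space {a\<in>A. d a \<le> \<rho> j})"
      by (rule nn_integral_count_space_restrict)
    also have "\<dots> \<le> ennreal ((C * (2 * \<rho> j) powr (n - \<mu>)) / (unit_ball_vol DIM('a) * \<epsilon> ^ DIM('a)))"
    proof (rule sum_d_power_le[where S = "frontier G + ball 0 (2 * \<rho> j)"])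
      fix a assume a: "a \<in> {a\<in>A. d a \<le> \<rho> j}"
      obtain b where b: "b \<in> frontier G" "d a = dist a b"
        using infdist_attains_inf[OF frontier_closed frG] by metis
      have da: "0 < d a" using a AG d_pos by auto
      have "\<epsilon> * d a \<le> d a / 100" using mult_right_mono[OF eps(2), of "d a"] by (simp add: infdist_nonneg)
      hence e: "\<epsilon> * d a < d a" using da by linarith
      show "cball a (\<epsilon> * d a) \<subseteq> frontier G + ball 0 (2 * \<rho> j)"
      proof
        fix y assume "y \<in> cball a (\<epsilon> * d a)"
        hence "dist b y < 2 * \<rho> j"
          using e b a dist_triangle[of b y a] dist_commute[of a b] by simp
        thus "y \<in> frontier G + ball 0 (2 * \<rho> j)" unfolding set_plus_ball_eq using b by auto
      qed
    next
      have "emeasure lborel (frontier G + ball 0 (2 * \<rho> j)) = emeasure lebesgue (frontier G + ball 0 (2 * \<rho> j))"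
        using open_set_plus_ball[of "frontier G" "2 * \<rho> j"] by simp
      thus "emeasure lborel (frontier G + ball 0 (2 * \<rho> j)) \<le> ennreal (C * (2 * \<rho> j) powr (n - \<mu>))"
        using C(2)[of "2 * \<rho> j"] \<rho>[of j] by simp
      show "frontier G + ball 0 (2 * \<rho> j) \<in> sets borel" by (intro borel_open open_set_plus_ball)
    qed (use C in auto)
    also have "(C * (2 * \<rho> j) powr (n - \<mu>)) / (unit_ball_vol DIM('a) * \<epsilon> ^ DIM('a)) = c * \<rho> j powr (n - \<mu>)"
      using \<rho>[of j] by (simp add: c_def powr_mult)
    finally show ?thesis .
  qed
  define q where "q = 2 powr - (n - \<mu> - \<eta>)"
  have q: "0 < q" "q < 1"
  proof -
    have "2 powr - (n - \<mu> - \<eta>) < (2::real) powr 0" using \<eta> by (intro powr_less_mono) (auto simp: n_def)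
    thus "0 < q" "q < 1" by (simp_all add: q_def)
  qed
  have "(\<integral>\<^sup>+a. ennreal (d a ^ DIM('a) * d a powr - \<eta>) \<partial>count_space A) \<le>
     (\<integral>\<^sup>+a. (\<Sum>j. ennreal (\<rho> (Suc j) powr - \<eta>) * (ennreal (d a ^ DIM('a)) * indicator {a. d a \<le> \<rho> j} a)) \<partial>count_space A)"
  proof (rule nn_integral_mono)
    fix a assume "a \<in> space (count_space A)"
    hence a: "0 < d a" "d a \<le> D" using AG d_pos D by auto
    \<comment> \<open>The scale with \<open>\<rho> (Suc j) < d a \<le> \<rho> j\<close>; starting at
      \<open>\<rho> 0 = D\<close> ensures that every centre has one.\<close>
    define j where "j = (LEAST j. \<rho> (Suc j) < d a)"
    have "\<exists>j. \<rho> (Suc j) < d a"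
    proof -
      obtain j where "D / d a < 2 ^ j" using real_arch_pow[of 2 "D / d a"] by auto
      hence "D < d a * 2 ^ j" using a by (simp add: field_simps)
      also have "\<dots> \<le> d a * 2 ^ Suc j" using a by simp
      finally show ?thesis by (intro exI[of _ j]) (simp add: \<rho>_def field_simps)
    qed
    hence j: "\<rho> (Suc j) < d a" unfolding j_def by (rule LeastI_ex)
    have j': "d a \<le> \<rho> j"
    proof (cases j)
      case 0
      thus ?thesis using a by (simp add: \<rho>_def)
    next
      case (Suc i)
      hence "i < j" by simp
      thus ?thesis using not_less_Least[of i "\<lambda>j. \<rho> (Suc j) < d a"] Suc by (simp add: j_def[symmetric])
    qed
    have "ennreal (d a ^ DIM('a) * d a powr - \<eta>) \<le> ennreal (\<rho> (Suc j) powr - \<eta> * d a ^ DIM('a))"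
    proof (rule ennreal_leI)
      have "d a powr - \<eta> \<le> \<rho> (Suc j) powr - \<eta>" using j \<rho>[of "Suc j"] \<eta> by (intro powr_mono2') auto
      hence "d a ^ DIM('a) * d a powr - \<eta> \<le> d a ^ DIM('a) * \<rho> (Suc j) powr - \<eta>"
        using a by (intro mult_left_mono) auto
      thus "d a ^ DIM('a) * d a powr - \<eta> \<le> \<rho> (Suc j) powr - \<eta> * d a ^ DIM('a)" by (simp add: mult.commute)
    qed
    also have "\<dots> = ennreal (\<rho> (Suc j) powr - \<eta>) * (ennreal (d a ^ DIM('a)) * indicator {a. d a \<le> \<rho> j} a)"
      using j' by (simp add: ennreal_mult infdist_nonneg)
    also have "\<dots> = (\<Sum>j\<in>{j}. ennreal (\<rho> (Suc j) powr - \<eta>) * (ennreal (d a ^ DIM('a)) * indicator {a. d a \<le> \<rho> j} a))"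
      by simp
    \<comment> \<open>The layers are nested, not disjoint; for an upper bound it is enough that the
      term of the right scale occurs in the series.\<close>
    also have "\<dots> \<le> (\<Sum>j. ennreal (\<rho> (Suc j) powr - \<eta>) * (ennreal (d a ^ DIM('a)) * indicator {a. d a \<le> \<rho> j} a))"
      by (rule sum_le_suminf) auto
    finally show "ennreal (d a ^ DIM('a) * d a powr - \<eta>) \<le>
      (\<Sum>j. ennreal (\<rho> (Suc j) powr - \<eta>) * (ennreal (d a ^ DIM('a)) * indicator {a. d a \<le> \<rho> j} a))" .
  qed
  also have "\<dots> = (\<Sum>j. \<integral>\<^sup>+a. ennreal (\<rho> (Suc j) powr - \<eta>) * (ennreal (d a ^ DIM('a)) * indicator {a. d a \<le> \<rho> j} a) \<partial>count_space A)"
    by (rule nn_integral_suminf) auto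
  also have "\<dots> = (\<Sum>j. ennreal (\<rho> (Suc j) powr - \<eta>) * (\<integral>\<^sup>+a. ennreal (d a ^ DIM('a)) * indicator {a. d a \<le> \<rho> j} a \<partial>count_space A))"
    by (intro suminf_cong nn_integral_cmult) auto
  also have "\<dots> \<le> (\<Sum>j. ennreal (\<rho> (Suc j) powr - \<eta>) * ennreal (c * \<rho> j powr (n - \<mu>)))"
    by (intro suminf_le mult_left_mono layer) auto
  also have "\<dots> = (\<Sum>j. ennreal (2 powr \<eta> * c * D powr (n - \<mu> - \<eta>) * q ^ j))"
  proof (rule suminf_cong)
    fix j
    have "\<rho> (Suc j) powr - \<eta> * (c * \<rho> j powr (n - \<mu>)) = 2 powr \<eta> * c * (\<rho> j powr - \<eta> * \<rho> j powr (n - \<mu>))"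
    proof -
      have half: "\<rho> (Suc j) = \<rho> j / 2" by (simp add: \<rho>_def)
      have "\<rho> (Suc j) powr - \<eta> = \<rho> j powr - \<eta> * 2 powr \<eta>"
        unfolding half using \<rho>[of j] by (simp add: powr_divide powr_minus_divide[of 2])
      thus ?thesis by simp
    qed
    also have "\<rho> j powr - \<eta> * \<rho> j powr (n - \<mu>) = \<rho> j powr (n - \<mu> - \<eta>)"
      by (simp add: powr_add[symmetric])
    also have "\<dots> = D powr (n - \<mu> - \<eta>) * q ^ j"
    proof -
      have "(2 ^ j) powr (n - \<mu> - \<eta>) = (2 powr (n - \<mu> - \<eta>)) ^ j"
        by (simp add: powr_realpow[symmetric] powr_powr powr_power mult.commute)
      moreover have "q = 1 / 2 powr (n - \<mu> - \<eta>)" unfolding q_def by (rule powr_minus_divide)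
      ultimately have "q ^ j = 1 / (2 ^ j) powr (n - \<mu> - \<eta>)" by (simp add: power_one_over)
      moreover have "(D / 2 ^ j) powr (n - \<mu> - \<eta>) = D powr (n - \<mu> - \<eta>) / (2 ^ j) powr (n - \<mu> - \<eta>)"
        using D0 by (intro powr_divide)
      ultimately show ?thesis unfolding \<rho>_def by simp
    qed
    finally have eq: "\<rho> (Suc j) powr - \<eta> * (c * \<rho> j powr (n - \<mu>)) =
        2 powr \<eta> * c * D powr (n - \<mu> - \<eta>) * q ^ j" by (simp only: mult.assoc)
    have "ennreal (\<rho> (Suc j) powr - \<eta>) * ennreal (c * \<rho> j powr (n - \<mu>)) =
        ennreal (\<rho> (Suc j) powr - \<eta> * (c * \<rho> j powr (n - \<mu>)))"
      using c by (intro ennreal_mult[symmetric]) auto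
    thus "ennreal (\<rho> (Suc j) powr - \<eta>) * ennreal (c * \<rho> j powr (n - \<mu>)) =
        ennreal (2 powr \<eta> * c * D powr (n - \<mu> - \<eta>) * q ^ j)"
      unfolding eq .
  qed
  also have "\<dots> < \<infinity>"
    unfolding infinity_ennreal_def less_top[symmetric]
    using q c by (intro ennreal_suminf_neq_top summable_mult summable_geometric) auto
  finally show ?thesis .
qed

end

section \<open>Local estimates\<close>

definition avg :: "('a::euclidean_space \<Rightarrow> real) \<Rightarrow> 'a set \<Rightarrow> real" where
  "avg v Y = (LINT y|lborel. indicator Y y *\<^sub>R v y) / measure lborel Y"

text \<open>The constant minus the average is the average of \<open>c - v\<close>. Multiplying by
  the measure avoids division in \<open>ennreal\<close>.\<close>

lemma avg_deviation_le:
  fixes v :: "'a::euclidean_space \<Rightarrow> real"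
  assumes Y: "Y \<in> sets borel" "emeasure lborel Y < \<infinity>" "0 < measure lborel Y"
    and v: "integrable lborel (\<lambda>y. indicator Y y *\<^sub>R v y)"
  shows "ennreal (measure lborel Y * \<bar>c - avg v Y\<bar>) \<le> (\<integral>\<^sup>+y. ennreal \<bar>c - v y\<bar> * indicator Y y \<partial>lborel)"
proof -
  have iY: "integrable lborel (\<lambda>y. indicator Y y *\<^sub>R c)"
    using Y by (intro integrable_scaleR_left integrable_real_indicator) auto
  have int: "integrable lborel (\<lambda>y. indicator Y y *\<^sub>R (c - v y))"
    using Bochner_Integration.integrable_diff[OF iY v] by (simp add: right_diff_distrib)
  have "measure lborel Y * (c - avg v Y) = measure lborel Y * c - (LINT y|lborel. indicator Y y *\<^sub>R v y)"
    using Y by (simp add: avg_def right_diff_distrib)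
  also have "measure lborel Y * c = (LINT y|lborel. indicator Y y *\<^sub>R c)"
    using Y by simp
  also have "\<dots> - (LINT y|lborel. indicator Y y *\<^sub>R v y) = (LINT y|lborel. indicator Y y *\<^sub>R (c - v y))"
    by (subst Bochner_Integration.integral_diff[OF iY v, symmetric]) (simp add: right_diff_distrib)
  finally have "measure lborel Y * \<bar>c - avg v Y\<bar> = \<bar>LINT y|lborel. indicator Y y *\<^sub>R (c - v y)\<bar>"
    using Y(3) by (metis abs_mult abs_of_pos)
  also have "ennreal \<dots> \<le> (\<integral>\<^sup>+y. ennreal (norm (indicator Y y *\<^sub>R (c - v y))) \<partial>lborel)"
    using integral_norm_bound_ennreal[OF int] by simp
  also have "\<dots> = (\<integral>\<^sup>+y. ennreal \<bar>c - v y\<bar> * indicator Y y \<partial>lborel)"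
    by (intro nn_integral_cong) (simp add: indicator_def)
  finally show ?thesis .
qed

text \<open>Once \<open>w > K\<close>, the factor \<open>(w / K) powr (p - 1)\<close> is at least 1.
  The threshold \<open>K\<close> remains free and is later tuned to each cell.\<close>

lemma le_add_powr:
  fixes w K p :: real
  assumes "w \<ge> 0" "K > 0" "p \<ge> 1"
  shows "w \<le> K + K powr (1 - p) * w powr p"
proof (cases "w \<le> K")
  case False
  hence "1 \<le> (w / K) powr (p - 1)" using assms by (intro ge_one_powr_ge_zero) (auto simp: field_simps)
  hence "w * 1 \<le> w * (w / K) powr (p - 1)" using assms by (intro mult_left_mono) auto
  also have "\<dots> = (w * w powr (p - 1)) * K powr - (p - 1)"
    unfolding powr_minus_divide[of K "p - 1"] using assms by (simp add: powr_divide)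
  also have "w * w powr (p - 1) = w powr p" using assms by (simp add: powr_mult_base)
  finally show ?thesis using assms by (simp add: mult.commute)
qed (simp add: add_increasing2)

text \<open>With \<open>q = n + \<delta> * p\<close> this is the integrand of the Gagliardo
  seminorm. The conventions for \<open>0 powr p\<close> and for division by zero give it the value 0
  on the diagonal.\<close>

definition gagliardo :: "('a::euclidean_space \<Rightarrow> real) \<Rightarrow> real \<Rightarrow> real \<Rightarrow> 'a \<Rightarrow> 'a \<Rightarrow> ennreal" where
  "gagliardo v p q x y = ennreal (\<bar>v x - v y\<bar> powr p / norm (x - y) powr q)"

lemma gagliardo_measurable [measurable]:
  assumes [measurable]: "v \<in> borel_measurable borel"
  shows "(\<lambda>(x, y). gagliardo v p q x y) \<in> borel_measurable (borel \<Otimes>\<^sub>M borel)"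
  unfolding gagliardo_def by measurable

text \<open>\<open>le_add_powr\<close> is applied to \<open>\<bar>v x - v y\<bar>\<close>, and off
  the diagonal the factor \<open>\<rho> powr q / norm (x - y) powr q \<ge> 1\<close> introduces the
  kernel. The constant part integrates to \<open>K * m\<^sup>2\<close>.\<close>

lemma double_integral_abs_diff_le:
  fixes v :: "'a::euclidean_space \<Rightarrow> real"
  assumes [measurable]: "v \<in> borel_measurable borel" "B \<in> sets borel"
    and diam: "\<And>x y. x \<in> B \<Longrightarrow> y \<in> B \<Longrightarrow> norm (x - y) \<le> \<rho>"
    and \<rho>: "\<rho> > 0" and K: "K > 0" and p: "p \<ge> 1" and q: "q \<ge> 0"
    and mB: "emeasure lborel B = ennreal m" "m \<ge> 0"
  shows "(\<integral>\<^sup>+x. (\<integral>\<^sup>+y. ennreal \<bar>v x - v y\<bar> * indicator B y \<partial>lborel) * indicator B x \<partial>lborel)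
     \<le> ennreal (K * m\<^sup>2) + ennreal (K powr (1 - p) * \<rho> powr q) *
        (\<integral>\<^sup>+x. (\<integral>\<^sup>+y. gagliardo v p q x y * indicator B y \<partial>lborel) * indicator B x \<partial>lborel)"
proof -
  define c where "c = K powr (1 - p) * \<rho> powr q"
  have c: "c \<ge> 0" by (simp add: c_def)
  note gagliardo_measurable[OF assms(1), measurable]
  have pw: "ennreal \<bar>v x - v y\<bar> \<le> ennreal K + ennreal c * gagliardo v p q x y"
    if "x \<in> B" "y \<in> B" for x y
  proof -
    have "\<bar>v x - v y\<bar> \<le> K + K powr (1 - p) * \<bar>v x - v y\<bar> powr p"
      using K p by (intro le_add_powr) auto
    also have "\<dots> \<le> K + c * (\<bar>v x - v y\<bar> powr p / norm (x - y) powr q)"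
    proof (cases "x = y")
      case False
      have "1 \<le> \<rho> powr q / norm (x - y) powr q"
        using diam[OF that] False q by (simp add: powr_mono2)
      hence "K powr (1 - p) * \<bar>v x - v y\<bar> powr p * 1 \<le>
          K powr (1 - p) * \<bar>v x - v y\<bar> powr p * (\<rho> powr q / norm (x - y) powr q)"
        by (intro mult_left_mono) auto
      thus ?thesis by (simp add: c_def mult_ac)
    qed auto
    finally have "ennreal \<bar>v x - v y\<bar> \<le> ennreal (K + c * (\<bar>v x - v y\<bar> powr p / norm (x - y) powr q))"
      by (rule ennreal_leI)
    also have "\<dots> = ennreal K + ennreal c * gagliardo v p q x y"
      using K c by (simp add: gagliardo_def ennreal_plus ennreal_mult[symmetric])
    finally show ?thesis .
  qed
  have "(\<integral>\<^sup>+x. (\<integral>\<^sup>+y. ennreal \<bar>v x - v y\<bar> * indicator B y \<partial>lborel) * indicator B x \<partial>lborel)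
     \<le> (\<integral>\<^sup>+x. (\<integral>\<^sup>+y. ennreal K * indicator B y + ennreal c * (gagliardo v p q x y * indicator B y) \<partial>lborel) * indicator B x \<partial>lborel)"
  proof (intro nn_integral_mono)
    fix x
    show "(\<integral>\<^sup>+y. ennreal \<bar>v x - v y\<bar> * indicator B y \<partial>lborel) * indicator B x
      \<le> (\<integral>\<^sup>+y. ennreal K * indicator B y + ennreal c * (gagliardo v p q x y * indicator B y) \<partial>lborel) * indicator B x"
    proof (cases "x \<in> B")
      case True
      have "(\<integral>\<^sup>+y. ennreal \<bar>v x - v y\<bar> * indicator B y \<partial>lborel)
        \<le> (\<integral>\<^sup>+y. ennreal K * indicator B y + ennreal c * (gagliardo v p q x y * indicator B y) \<partial>lborel)"
        using pw[OF True] by (intro nn_integral_mono) (simp add: indicator_def)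
      thus ?thesis by (intro mult_right_mono) auto
    qed simp
  qed
  also have "\<dots> = (\<integral>\<^sup>+x. ennreal K * ennreal m * indicator B x + ennreal c *
      ((\<integral>\<^sup>+y. gagliardo v p q x y * indicator B y \<partial>lborel) * indicator B x) \<partial>lborel)"
  proof (intro nn_integral_cong)
    fix x :: 'a
    have [measurable]: "(\<lambda>y. gagliardo v p q x y) \<in> borel_measurable borel" by measurable
    have "(\<integral>\<^sup>+y. ennreal K * indicator B y + ennreal c * (gagliardo v p q x y * indicator B y) \<partial>lborel) =
       ennreal K * ennreal m + ennreal c * (\<integral>\<^sup>+y. gagliardo v p q x y * indicator B y \<partial>lborel)"
      by (subst nn_integral_add) (auto simp: nn_integral_cmult nn_integral_cmult_indicator mB)
    thus "(\<integral>\<^sup>+y. ennreal K * indicator B y + ennreal c * (gagliardo v p q x y * indicator B y) \<partial>lborel) * indicator B x =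
       ennreal K * ennreal m * indicator B x + ennreal c * ((\<integral>\<^sup>+y. gagliardo v p q x y * indicator B y \<partial>lborel) * indicator B x)"
      by (simp add: distrib_right mult.assoc)
  qed
  also have "\<dots> = ennreal K * ennreal m * ennreal m + ennreal c *
      (\<integral>\<^sup>+x. (\<integral>\<^sup>+y. gagliardo v p q x y * indicator B y \<partial>lborel) * indicator B x \<partial>lborel)"
    by (subst nn_integral_add) (auto simp: nn_integral_cmult nn_integral_cmult_indicator mB)
  also have "ennreal K * ennreal m * ennreal m = ennreal (K * m\<^sup>2)"
    using K mB by (simp add: ennreal_mult[symmetric] power2_eq_square mult.assoc)
  finally show ?thesis unfolding c_def .
qed

text \<open>Averaging in \<open>y\<close> over \<open>Y\<close>, and for the second claim also in
  \<open>x\<close> over \<open>X\<close>: each average costs its measure as a factor, and enlarging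
  the sets to \<open>W\<close> only increases the double integral.\<close>

lemma avg_double_integral:
  fixes v :: "'a::euclidean_space \<Rightarrow> real"
  assumes [measurable]: "v \<in> borel_measurable borel" and XY: "X \<in> sets borel" "Y \<in> sets borel" "X \<subseteq> W" "Y \<subseteq> W"
    and fin: "emeasure lborel X < \<infinity>" "emeasure lborel Y < \<infinity>" "0 < measure lborel X" "0 < measure lborel Y"
    and v: "integrable lborel (\<lambda>y. indicator X y *\<^sub>R v y)" "integrable lborel (\<lambda>y. indicator Y y *\<^sub>R v y)"
  defines "E \<equiv> (\<integral>\<^sup>+x. (\<integral>\<^sup>+y. ennreal \<bar>v x - v y\<bar> * indicator W y \<partial>lborel) * indicator W x \<partial>lborel)"
  shows "ennreal (measure lborel Y) * (\<integral>\<^sup>+x. ennreal \<bar>v x - avg v Y\<bar> * indicator X x \<partial>lborel) \<le> E"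
    and "ennreal (measure lborel X * measure lborel Y * \<bar>avg v X - avg v Y\<bar>) \<le> E"
proof -
  note XY(1,2)[measurable]
  have "ennreal (measure lborel Y) * (\<integral>\<^sup>+x. ennreal \<bar>v x - avg v Y\<bar> * indicator X x \<partial>lborel) =
     (\<integral>\<^sup>+x. ennreal (measure lborel Y) * (ennreal \<bar>v x - avg v Y\<bar> * indicator X x) \<partial>lborel)"
    by (intro nn_integral_cmult[symmetric]) measurable
  also have "\<dots> \<le> E"
    unfolding E_def
  proof (rule nn_integral_mono)
    fix x
    show "ennreal (measure lborel Y) * (ennreal \<bar>v x - avg v Y\<bar> * indicator X x) \<le>
        (\<integral>\<^sup>+y. ennreal \<bar>v x - v y\<bar> * indicator W y \<partial>lborel) * indicator W x"
    proof (cases "x \<in> X")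
      case True
      have "ennreal (measure lborel Y) * ennreal \<bar>v x - avg v Y\<bar> = ennreal (measure lborel Y * \<bar>v x - avg v Y\<bar>)"
        by (simp add: ennreal_mult)
      also have "\<dots> \<le> (\<integral>\<^sup>+y. ennreal \<bar>v x - v y\<bar> * indicator Y y \<partial>lborel)"
        by (rule avg_deviation_le) (use XY fin v in auto)
      also have "\<dots> \<le> (\<integral>\<^sup>+y. ennreal \<bar>v x - v y\<bar> * indicator W y \<partial>lborel)"
        using XY by (intro nn_integral_mono mult_left_mono) (auto simp: indicator_def)
      finally show ?thesis using True XY by (auto simp: indicator_def)
    qed simp
  qed
  finally show 1: "ennreal (measure lborel Y) * (\<integral>\<^sup>+x. ennreal \<bar>v x - avg v Y\<bar> * indicator X x \<partial>lborel) \<le> E" .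
  have "ennreal (measure lborel X * measure lborel Y * \<bar>avg v X - avg v Y\<bar>) =
      ennreal (measure lborel Y) * ennreal (measure lborel X * \<bar>avg v Y - avg v X\<bar>)"
    by (subst ennreal_mult[symmetric]) (auto simp: abs_minus_commute mult_ac)
  also have "\<dots> \<le> ennreal (measure lborel Y) * (\<integral>\<^sup>+x. ennreal \<bar>avg v Y - v x\<bar> * indicator X x \<partial>lborel)"
    by (intro mult_left_mono avg_deviation_le) (use XY fin v in auto)
  also have "\<dots> \<le> E" using 1 by (simp add: abs_minus_commute)
  finally show "ennreal (measure lborel X * measure lborel Y * \<bar>avg v X - avg v Y\<bar>) \<le> E" .
qed

section \<open>Oscillation and energy on the cells\<close>

context whitney_cover
begin

abbreviation near :: "'a \<Rightarrow> 'a set" where "near a \<equiv> cball a (5 * (\<epsilon> * d a))"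

abbreviation wide :: "'a \<Rightarrow> 'a set" where "wide a \<equiv> cball a (20 * (\<epsilon> * d a))"

definition energy :: "('a \<Rightarrow> real) \<Rightarrow> real \<Rightarrow> real \<Rightarrow> 'a \<Rightarrow> ennreal" where
  "energy v p q a = (\<integral>\<^sup>+x. (\<integral>\<^sup>+y. gagliardo v p q x y * indicator (wide a) y \<partial>lborel) * indicator (wide a) x \<partial>lborel)"

lemma wide_radius_nonneg: "0 \<le> c \<Longrightarrow> 0 \<le> c * (\<epsilon> * d a)"
  using eps by (simp add: infdist_nonneg)

lemma measure_cball_eq:
  assumes "0 \<le> c"
  shows "measure lborel (cball a (c * (\<epsilon> * d a))) = unit_ball_vol (real DIM('a)) * (c * \<epsilon>) ^ DIM('a) * d a ^ DIM('a)"
    and "emeasure lborel (cball a (c * (\<epsilon> * d a))) = ennreal (unit_ball_vol (real DIM('a)) * (c * \<epsilon>) ^ DIM('a) * d a ^ DIM('a))"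
proof -
  show 1: "emeasure lborel (cball a (c * (\<epsilon> * d a))) = ennreal (unit_ball_vol (real DIM('a)) * (c * \<epsilon>) ^ DIM('a) * d a ^ DIM('a))"
    using emeasure_cball[OF wide_radius_nonneg[OF assms], of a a] by (simp add: power_mult_distrib mult.assoc)
  have "0 \<le> unit_ball_vol (real DIM('a)) * (c * \<epsilon>) ^ DIM('a) * d a ^ DIM('a)"
    using assms eps by (simp add: infdist_nonneg less_imp_le)
  thus "measure lborel (cball a (c * (\<epsilon> * d a))) = unit_ball_vol (real DIM('a)) * (c * \<epsilon>) ^ DIM('a) * d a ^ DIM('a)"
    by (rule measure_eq_emeasure_eq_ennreal) (rule 1)
qed

lemma near_subset_wide: "near a \<subseteq> wide a"
  using wide_radius_nonneg[of 1 a] by (intro subset_cball) linarith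

text \<open>The threshold \<open>K = J powr (1 / p) * d a powr \<beta>\<close> is inserted on the
  wide ball. The relation imposed on \<open>\<beta>\<close> makes
  \<open>K powr (1 - p) * d a powr q\<close> a multiple of
  \<open>d a powr - (n / s) * (d a ^ n)\<^sup>2\<close>, and the square cancels against the two
  measures.\<close>

lemma local_poincare:
  fixes v :: "'a \<Rightarrow> real" and J p q s \<beta> :: real
  assumes v[measurable]: "v \<in> borel_measurable borel" and iv: "integrable lborel (\<lambda>y. indicator G y *\<^sub>R v y)"
    and p: "p > 1" and q: "q \<ge> 0" and J: "J > 0"
    and \<beta>: "\<beta> * (p - 1) = q - 2 * real DIM('a) + real DIM('a) / s"
    and a: "a \<in> A" and fin: "energy v p q a < \<infinity>"
  defines "h \<equiv> 32 ^ DIM('a) * (J powr (1 / p) * d a powr \<beta>) +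
      2 ^ DIM('a) * (40 * \<epsilon>) powr q / (unit_ball_vol (real DIM('a)) * (5 * \<epsilon>) ^ DIM('a))\<^sup>2 *
        (J powr (1 / p - 1) * (d a powr - (real DIM('a) / s) * enn2real (energy v p q a)))"
  shows "(\<integral>\<^sup>+x. ennreal \<bar>v x - avg v (near a)\<bar> * indicator (near a) x \<partial>lborel) \<le> ennreal (measure lborel (near a) * h)"
    and "\<And>b. b \<in> A \<Longrightarrow> adjacent a b \<Longrightarrow> \<bar>avg v (near a) - avg v (near b)\<bar> \<le> h"
proof -
  define n where "n = DIM('a)"
  define \<omega> where "\<omega> = unit_ball_vol (real n)"
  have \<omega>: "\<omega> > 0" by (simp add: \<omega>_def)
  have aG: "a \<in> G" using a AG by auto
  have da: "d a > 0" by (rule d_pos[OF aG])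
  define E where "E = (\<integral>\<^sup>+x. (\<integral>\<^sup>+y. ennreal \<bar>v x - v y\<bar> * indicator (wide a) y \<partial>lborel) * indicator (wide a) x \<partial>lborel)"
  define I where "I = enn2real (energy v p q a)"
  have I: "energy v p q a = ennreal I" "I \<ge> 0"
    using fin by (auto simp: I_def less_top)
  define K where "K = J powr (1 / p) * d a powr \<beta>"
  have K: "K > 0" using J da by (simp add: K_def)
  define m where "m = measure lborel (near a)"
  have m: "m = \<omega> * (5 * \<epsilon>) ^ n * d a ^ n" unfolding m_def \<omega>_def n_def by (rule measure_cball_eq) simp
  have mpos: "m > 0" unfolding m using \<omega> eps da by simp
  have hE: "h = 32 ^ n * K + 2 ^ n * (40 * \<epsilon>) powr q / (\<omega> * (5 * \<epsilon>) ^ n)\<^sup>2 *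
        (J powr (1 / p - 1) * (d a powr - (real n / s) * I))"
    by (simp add: h_def K_def n_def \<omega>_def I_def)
  have h: "h \<ge> 0" unfolding hE using K I \<omega> by simp
  have "E \<le> ennreal (K * (\<omega> * (20 * \<epsilon>) ^ n * d a ^ n)\<^sup>2) + ennreal (K powr (1 - p) * (40 * (\<epsilon> * d a)) powr q) *
        (\<integral>\<^sup>+x. (\<integral>\<^sup>+y. gagliardo v p q x y * indicator (wide a) y \<partial>lborel) * indicator (wide a) x \<partial>lborel)"
    unfolding E_def
  proof (rule double_integral_abs_diff_le)
    show "norm (x - y) \<le> 40 * (\<epsilon> * d a)" if "x \<in> wide a" "y \<in> wide a" for x y
    proof -
      have "dist x y \<le> dist a x + dist a y" by (metis dist_commute dist_triangle)
      thus ?thesis using that by (simp add: dist_norm)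
    qed
    show "emeasure lborel (wide a) = ennreal (\<omega> * (20 * \<epsilon>) ^ n * d a ^ n)"
      unfolding \<omega>_def n_def by (rule measure_cball_eq) simp
  qed (use v p q K eps da \<omega> in \<open>auto simp: less_imp_le\<close>)
  also have "\<dots> = ennreal (K * (\<omega> * (20 * \<epsilon>) ^ n * d a ^ n)\<^sup>2) + ennreal (K powr (1 - p) * (40 * (\<epsilon> * d a)) powr q) * ennreal I"
    unfolding energy_def[symmetric] I ..
  also have "\<dots> = ennreal (K * (\<omega> * (20 * \<epsilon>) ^ n * d a ^ n)\<^sup>2 + K powr (1 - p) * (40 * (\<epsilon> * d a)) powr q * I)"
    using K I by (simp add: ennreal_mult[symmetric] ennreal_plus[symmetric] del: ennreal_plus)
  finally have E1: "E \<le> ennreal (K * (\<omega> * (20 * \<epsilon>) ^ n * d a ^ n)\<^sup>2 + K powr (1 - p) * (40 * (\<epsilon> * d a)) powr q * I)" .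
  have pow: "K powr (1 - p) * d a powr q = J powr (1 / p - 1) * d a powr - (real n / s) * (d a ^ n)\<^sup>2"
  proof -
    have "K powr (1 - p) = J powr (1 / p * (1 - p)) * d a powr (\<beta> * (1 - p))"
      by (simp add: K_def powr_mult powr_powr)
    also have "1 / p * (1 - p) = 1 / p - 1" using p by (simp add: field_simps)
    also have "\<beta> * (1 - p) = - (q - 2 * real n + real n / s)" using \<beta> by (simp add: n_def algebra_simps)
    finally have "K powr (1 - p) * d a powr q = J powr (1 / p - 1) * (d a powr (- (q - 2 * real n + real n / s)) * d a powr q)"
      by simp
    also have "d a powr (- (q - 2 * real n + real n / s)) * d a powr q = d a powr (- (real n / s) + (real n + real n))"
    proof -
      have "- (q - 2 * real n + real n / s) + q = - (real n / s) + (real n + real n)" by simp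
      thus ?thesis by (simp only: powr_add[symmetric])
    qed
    also have "\<dots> = d a powr - (real n / s) * (d a ^ n)\<^sup>2"
      using da by (simp only: powr_add powr_realpow power2_eq_square)
    finally show ?thesis by simp
  qed
  \<comment> \<open>The wide radius is 4 times the near one, giving \<open>(4 ^ n)\<^sup>2\<close>;
    the further \<open>2 ^ n\<close> anticipates a smaller neighbouring ball. Together they make
    \<open>32 ^ n\<close>.\<close>
  have E2: "2 ^ n * (K * (\<omega> * (20 * \<epsilon>) ^ n * d a ^ n)\<^sup>2 + K powr (1 - p) * (40 * (\<epsilon> * d a)) powr q * I) = m\<^sup>2 * h"
  proof -
    have "20 * \<epsilon> = 4 * (5 * \<epsilon>)" by simp
    hence e20: "(20 * \<epsilon>) ^ n = 4 ^ n * (5 * \<epsilon>) ^ n" by (simp only: power_mult_distrib)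
    have "(2::real) ^ n * (4 ^ n)\<^sup>2 = (2 * (4 * 4)) ^ n"
      by (simp only: power2_eq_square power_mult_distrib)
    hence e32: "2 ^ n * (4 ^ n)\<^sup>2 = (32::real) ^ n" by simp
    have "2 ^ n * (K * (\<omega> * (20 * \<epsilon>) ^ n * d a ^ n)\<^sup>2) = (2 ^ n * (4 ^ n)\<^sup>2) * K * m\<^sup>2"
      unfolding m e20 by (simp only: power2_eq_square mult_ac)
    hence "2 ^ n * (K * (\<omega> * (20 * \<epsilon>) ^ n * d a ^ n)\<^sup>2) = m\<^sup>2 * (32 ^ n * K)"
      unfolding e32 by (simp only: mult_ac)
    moreover have "2 ^ n * (K powr (1 - p) * (40 * (\<epsilon> * d a)) powr q * I) =
      m\<^sup>2 * (2 ^ n * (40 * \<epsilon>) powr q / (\<omega> * (5 * \<epsilon>) ^ n)\<^sup>2 * (J powr (1 / p - 1) * (d a powr - (real n / s) * I)))"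
    proof -
      have "(40 * (\<epsilon> * d a)) powr q = (40 * \<epsilon>) powr q * d a powr q"
        using eps da powr_mult[of "40 * \<epsilon>" "d a" q] by (simp add: mult.assoc)
      hence "2 ^ n * (K powr (1 - p) * (40 * (\<epsilon> * d a)) powr q * I) =
          2 ^ n * (40 * \<epsilon>) powr q * I * (K powr (1 - p) * d a powr q)" by (simp only: mult_ac)
      also have "\<dots> = 2 ^ n * (40 * \<epsilon>) powr q * I * (J powr (1 / p - 1) * d a powr - (real n / s) * (d a ^ n)\<^sup>2)"
        unfolding pow ..
      also have "\<dots> = (\<omega> * (5 * \<epsilon>) ^ n)\<^sup>2 * (d a ^ n)\<^sup>2 * (2 ^ n * (40 * \<epsilon>) powr q / (\<omega> * (5 * \<epsilon>) ^ n)\<^sup>2 *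
          (J powr (1 / p - 1) * (d a powr - (real n / s) * I)))"
        using \<omega> eps by simp
      also have "(\<omega> * (5 * \<epsilon>) ^ n)\<^sup>2 * (d a ^ n)\<^sup>2 = m\<^sup>2" unfolding m by (simp only: power_mult_distrib)
      finally show ?thesis .
    qed
    ultimately show ?thesis unfolding hE distrib_left by (simp only:)
  qed
  have E3: "ennreal (2 ^ n) * E \<le> ennreal (m\<^sup>2 * h)"
  proof -
    have "ennreal (2 ^ n) * E \<le> ennreal (2 ^ n) * ennreal (K * (\<omega> * (20 * \<epsilon>) ^ n * d a ^ n)\<^sup>2 + K powr (1 - p) * (40 * (\<epsilon> * d a)) powr q * I)"
      by (intro mult_left_mono E1) auto
    also have "\<dots> = ennreal (2 ^ n * (K * (\<omega> * (20 * \<epsilon>) ^ n * d a ^ n)\<^sup>2 + K powr (1 - p) * (40 * (\<epsilon> * d a)) powr q * I))"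
      using K I by (intro ennreal_mult[symmetric]) auto
    finally show ?thesis unfolding E2 .
  qed
  have int: "integrable lborel (\<lambda>y. indicator X y *\<^sub>R v y)" if "X \<in> sets borel" "X \<subseteq> G" for X
  proof -
    have "integrable lborel (\<lambda>y. indicator X y *\<^sub>R (indicator G y *\<^sub>R v y))"
      by (rule integrable_mult_indicator[OF _ iv]) (use that in simp)
    also have "(\<lambda>y. indicator X y *\<^sub>R (indicator G y *\<^sub>R v y)) = (\<lambda>y. indicator X y *\<^sub>R v y)"
      using that by (auto simp: indicator_def fun_eq_iff)
    finally show ?thesis .
  qed
  have wG: "wide a \<subseteq> G" by (rule cball_subset_G[OF aG])
  have nG: "near a \<subseteq> G" using wG near_subset_wide by blast
  have meas: "cball x r \<in> sets borel" for x :: 'a and r by simp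
  have two: "(1::real) \<le> 2 ^ n" by simp
  show "(\<integral>\<^sup>+x. ennreal \<bar>v x - avg v (near a)\<bar> * indicator (near a) x \<partial>lborel) \<le> ennreal (measure lborel (near a) * h)"
  proof -
    define X where "X = (\<integral>\<^sup>+x. ennreal \<bar>v x - avg v (near a)\<bar> * indicator (near a) x \<partial>lborel)"
    have "ennreal m * X \<le> E"
      unfolding X_def E_def m_def
      by (rule avg_double_integral(1)[OF v meas meas near_subset_wide near_subset_wide
            emeasure_lborel_cball_finite emeasure_lborel_cball_finite mpos[unfolded m_def] mpos[unfolded m_def]
            int[OF meas nG] int[OF meas nG]])
    also have "\<dots> = ennreal 1 * E" by simp
    also have "\<dots> \<le> ennreal (2 ^ n) * E" using two by (intro mult_right_mono ennreal_leI) auto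
    also have "\<dots> \<le> ennreal (m\<^sup>2 * h)" by (rule E3)
    finally have "ennreal (1 / m) * (ennreal m * X) \<le> ennreal (1 / m) * ennreal (m\<^sup>2 * h)"
      by (rule mult_left_mono) simp
    moreover have "ennreal (1 / m) * (ennreal m * X) = X"
      using mpos by (simp add: mult.assoc[symmetric] ennreal_mult[symmetric])
    moreover have "ennreal (1 / m) * ennreal (m\<^sup>2 * h) = ennreal (m * h)"
      using mpos h by (simp add: ennreal_mult[symmetric] power2_eq_square)
    ultimately show ?thesis by (simp add: X_def m_def)
  qed
  fix b assume b: "b \<in> A" and adj: "adjacent a b"
  have bG: "b \<in> G" using b AG by auto
  have db: "d b > 0" by (rule d_pos[OF bG])
  have sub: "near b \<subseteq> wide a" by (rule conjunct1[OF adj[unfolded adjacent_def]])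
  have half: "d a \<le> 2 * d b" by (rule conjunct2[OF conjunct2[OF adj[unfolded adjacent_def]]])
  define mb where "mb = measure lborel (near b)"
  have mb: "mb = \<omega> * (5 * \<epsilon>) ^ n * d b ^ n" unfolding mb_def \<omega>_def n_def by (rule measure_cball_eq) simp
  have mbpos: "mb > 0" unfolding mb using \<omega> eps db by simp
  \<comment> \<open>A neighbouring near ball has at least half the radius, so comparing its measure
    with that of \<open>near a\<close> costs \<open>2 ^ n\<close>.\<close>
  have "d a ^ n \<le> (2 * d b) ^ n" using half by (intro power_mono) (auto simp: infdist_nonneg)
  hence "(\<omega> * (5 * \<epsilon>) ^ n) * d a ^ n \<le> (\<omega> * (5 * \<epsilon>) ^ n) * (2 * d b) ^ n"
    using \<omega> eps by (intro mult_left_mono) auto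
  hence mab: "m \<le> 2 ^ n * mb" unfolding m mb by (simp add: power_mult_distrib mult_ac)
  have bG': "near b \<subseteq> G" using sub wG by blast
  define \<Delta> where "\<Delta> = \<bar>avg v (near a) - avg v (near b)\<bar>"
  have "ennreal (m * mb * \<Delta>) \<le> E"
    unfolding \<Delta>_def E_def m_def mb_def
    by (rule avg_double_integral(2)[OF v meas meas near_subset_wide sub
            emeasure_lborel_cball_finite emeasure_lborel_cball_finite mpos[unfolded m_def] mbpos[unfolded mb_def]
            int[OF meas nG] int[OF meas bG']])
  hence "ennreal (2 ^ n) * ennreal (m * mb * \<Delta>) \<le> ennreal (2 ^ n) * E" by (intro mult_left_mono) auto
  also have "\<dots> \<le> ennreal (m\<^sup>2 * h)" by (rule E3)
  finally have "ennreal (2 ^ n * (m * mb * \<Delta>)) \<le> ennreal (m\<^sup>2 * h)"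
    using mpos mbpos by (subst ennreal_mult) (auto simp: \<Delta>_def)
  hence "2 ^ n * (m * mb * \<Delta>) \<le> m\<^sup>2 * h" using h by (subst (asm) ennreal_le_iff) auto
  moreover have "m * (m * \<Delta>) \<le> m * ((2 ^ n * mb) * \<Delta>)"
    using mab mpos by (intro mult_left_mono mult_right_mono) (auto simp: \<Delta>_def)
  ultimately have "m\<^sup>2 * \<Delta> \<le> m\<^sup>2 * h" by (simp add: power2_eq_square mult_ac)
  hence "\<Delta> \<le> h" using mpos by simp
  thus "\<bar>avg v (near a) - avg v (near b)\<bar> \<le> h" by (simp add: \<Delta>_def)
qed

text \<open>Two points \<open>x\<close>, \<open>y\<close> of one wide ball are closer than
  \<open>50 * (\<epsilon> * d a)\<close>, hence closer than \<open>\<tau> * d x\<close>. The square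
  of each wide ball is thus part of the domain on the right, and bounded overlap sums the
  pieces.\<close>

lemma sum_energy_le:
  fixes v :: "'a \<Rightarrow> real"
  assumes v[measurable]: "v \<in> borel_measurable borel" and \<tau>: "100 * \<epsilon> \<le> \<tau>"
  shows "(\<integral>\<^sup>+a. energy v p q a \<partial>count_space A) \<le> ennreal ((2 / \<epsilon>) ^ DIM('a)) *
    (\<integral>\<^sup>+x. (\<integral>\<^sup>+y. gagliardo v p q x y * indicator (G \<inter> ball x (\<tau> * d x)) y \<partial>lborel) * indicator G x \<partial>lborel)"
proof -
  define H where "H x = (\<integral>\<^sup>+y. gagliardo v p q x y * indicator (G \<inter> ball x (\<tau> * d x)) y \<partial>lborel)" for x
  have Gm[measurable]: "G \<in> sets borel" using openG by auto
  have dm[measurable]: "d \<in> borel_measurable borel"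
    by (intro borel_measurable_continuous_onI continuous_intros)
  note gagliardo_measurable[OF v, measurable]
  \<comment> \<open>The moving domain of the inner integral is written as a subset of the product
    space, so that the inner integral depends measurably on \<open>x\<close>.\<close>
  have "(\<lambda>(x, y). gagliardo v p q x y * indicator {z. snd z \<in> G \<and> dist (fst z) (snd z) < \<tau> * d (fst z)} (x, y))
      \<in> borel_measurable (borel \<Otimes>\<^sub>M lborel)"
    by measurable
  hence "(\<lambda>x. \<integral>\<^sup>+y. gagliardo v p q x y * indicator {z. snd z \<in> G \<and> dist (fst z) (snd z) < \<tau> * d (fst z)} (x, y) \<partial>lborel)
      \<in> borel_measurable borel"
    by (rule lborel.borel_measurable_nn_integral)
  also have "(\<lambda>x. \<integral>\<^sup>+y. gagliardo v p q x y * indicator {z. snd z \<in> G \<and> dist (fst z) (snd z) < \<tau> * d (fst z)} (x, y) \<partial>lborel) = H"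
    unfolding H_def by (intro ext nn_integral_cong) (simp add: indicator_def)
  finally have [measurable]: "H \<in> borel_measurable borel" .
  have "(\<integral>\<^sup>+a. energy v p q a \<partial>count_space A) \<le> (\<integral>\<^sup>+a. (\<integral>\<^sup>+x. H x * indicator (wide a) x \<partial>lborel) \<partial>count_space A)"
  proof (rule nn_integral_mono)
    fix a assume "a \<in> space (count_space A)"
    hence aG: "a \<in> G" using AG by auto
    show "energy v p q a \<le> (\<integral>\<^sup>+x. H x * indicator (wide a) x \<partial>lborel)"
      unfolding energy_def
    proof (rule nn_integral_mono)
      fix x
      show "(\<integral>\<^sup>+y. gagliardo v p q x y * indicator (wide a) y \<partial>lborel) * indicator (wide a) x \<le> H x * indicator (wide a) x"
      proof (cases "x \<in> wide a")
        case True
        have "dist a x \<le> 20 * (\<epsilon> * d a)" using True by simp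
        hence dx: "d a \<le> 2 * d x" by (rule d_comparable(1)[OF aG])
        have pos: "0 < d a" by (rule d_pos[OF aG])
        have "wide a \<subseteq> G \<inter> ball x (\<tau> * d x)"
        proof
          fix y assume y: "y \<in> wide a"
          have "dist x y \<le> dist a x + dist a y" by (metis dist_commute dist_triangle)
          also have "\<dots> \<le> 40 * (\<epsilon> * d a)" using True y unfolding mem_cball by linarith
          also have "\<dots> < 50 * (\<epsilon> * d a)" using mult_pos_pos[OF eps(1) pos] by linarith
          also have "\<dots> \<le> 50 * (\<epsilon> * (2 * d x))"
            by (intro mult_left_mono dx) (use eps in simp_all)
          also have "\<dots> = (100 * \<epsilon>) * d x" by simp
          also have "\<dots> \<le> \<tau> * d x" by (intro mult_right_mono \<tau>) (simp add: infdist_nonneg)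
          finally show "y \<in> G \<inter> ball x (\<tau> * d x)" using y cball_subset_G[OF aG] by auto
        qed
        hence "(\<integral>\<^sup>+y. gagliardo v p q x y * indicator (wide a) y \<partial>lborel) \<le> H x"
          unfolding H_def by (intro nn_integral_mono mult_left_mono) (auto simp: indicator_def)
        thus ?thesis by (intro mult_right_mono) auto
      qed simp
    qed
  qed
  also have "\<dots> = (\<integral>\<^sup>+x. (\<integral>\<^sup>+a. H x * indicator (wide a) x \<partial>count_space A) \<partial>lborel)"
  proof (rule nn_integral_count_space_nn_integral[OF cA, symmetric])
    fix a
    have [measurable]: "wide a \<in> sets borel" by simp
    show "(\<lambda>x. H x * indicator (wide a) x) \<in> borel_measurable lborel" by measurable
  qed
  also have "\<dots> = (\<integral>\<^sup>+x. H x * (\<integral>\<^sup>+a. indicator (wide a) x \<partial>count_space A) \<partial>lborel)"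
    by (intro nn_integral_cong nn_integral_cmult) auto
  also have "\<dots> \<le> (\<integral>\<^sup>+x. H x * (ennreal ((2 / \<epsilon>) ^ DIM('a)) * indicator G x) \<partial>lborel)"
    by (intro nn_integral_mono mult_left_mono overlap_bound) auto
  also have "\<dots> = (\<integral>\<^sup>+x. ennreal ((2 / \<epsilon>) ^ DIM('a)) * (H x * indicator G x) \<partial>lborel)"
    by (intro nn_integral_cong) (simp add: mult_ac)
  also have "\<dots> = ennreal ((2 / \<epsilon>) ^ DIM('a)) * (\<integral>\<^sup>+x. H x * indicator G x \<partial>lborel)"
    by (intro nn_integral_cmult) measurable
  finally show ?thesis unfolding H_def .
qed

end

section \<open>Summation over chains\<close>

context whitney_cover
begin

text \<open>Tonelli for counting measures: sums over chains become sums over shadows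
  \<open>{a. r \<in> C a}\<close>.\<close>

lemma nn_integral_swap_chains:
  fixes f g :: "'a \<Rightarrow> ennreal"
  assumes "\<And>a. a \<in> A \<Longrightarrow> C a \<subseteq> A" "\<And>a. a \<in> A \<Longrightarrow> finite (C a)"
  shows "(\<integral>\<^sup>+a. f a * (\<Sum>r\<in>C a. g r) \<partial>count_space A) =
         (\<integral>\<^sup>+r. g r * (\<integral>\<^sup>+a. f a * indicator {a. r \<in> C a} a \<partial>count_space A) \<partial>count_space A)"
proof -
  have "(\<integral>\<^sup>+a. f a * (\<Sum>r\<in>C a. g r) \<partial>count_space A) =
        (\<integral>\<^sup>+a. (\<integral>\<^sup>+r. f a * (g r * indicator (C a) r) \<partial>count_space A) \<partial>count_space A)"
  proof (rule nn_integral_cong)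
    fix a assume "a \<in> space (count_space A)"
    hence a: "a \<in> A" by simp
    have "(\<integral>\<^sup>+r. g r * indicator (C a) r \<partial>count_space A) = (\<Sum>r\<in>C a. g r * indicator (C a) r)"
      using assms a by (intro nn_integral_count_space') auto
    hence "(\<Sum>r\<in>C a. g r) = (\<integral>\<^sup>+r. g r * indicator (C a) r \<partial>count_space A)" by simp
    thus "f a * (\<Sum>r\<in>C a. g r) = (\<integral>\<^sup>+r. f a * (g r * indicator (C a) r) \<partial>count_space A)"
      by (simp add: nn_integral_cmult)
  qed
  also have "\<dots> = (\<integral>\<^sup>+r. (\<integral>\<^sup>+a. f a * (g r * indicator (C a) r) \<partial>count_space A) \<partial>count_space A)"
    by (rule nn_integral_count_space_nn_integral[OF cA]) simp
  also have "\<dots> = (\<integral>\<^sup>+r. g r * (\<integral>\<^sup>+a. f a * indicator {a. r \<in> C a} a \<partial>count_space A) \<partial>count_space A)"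
  proof (rule nn_integral_cong)
    fix r
    have "(\<integral>\<^sup>+a. f a * (g r * indicator (C a) r) \<partial>count_space A) =
        (\<integral>\<^sup>+a. g r * (f a * indicator {a. r \<in> C a} a) \<partial>count_space A)"
      by (intro nn_integral_cong) (simp add: indicator_def mult.commute)
    thus "(\<integral>\<^sup>+a. f a * (g r * indicator (C a) r) \<partial>count_space A) =
        g r * (\<integral>\<^sup>+a. f a * indicator {a. r \<in> C a} a \<partial>count_space A)"
      by (simp add: nn_integral_cmult)
  qed
  finally show ?thesis .
qed

text \<open>Every point of \<open>G\<close> lies in some \<open>near b\<close>; counting it several
  times only increases the right-hand side.\<close>

lemma nn_integral_near_cover_le:
  fixes v :: "'a \<Rightarrow> real"
  assumes [measurable]: "v \<in> borel_measurable borel"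
  shows "(\<integral>\<^sup>+x. ennreal \<bar>v x - k\<bar> * indicator G x \<partial>lborel) \<le>
    (\<integral>\<^sup>+a. (\<integral>\<^sup>+x. ennreal \<bar>v x - k\<bar> * indicator (near a) x \<partial>lborel) \<partial>count_space A)"
proof -
  have "(\<integral>\<^sup>+x. ennreal \<bar>v x - k\<bar> * indicator G x \<partial>lborel) \<le>
    (\<integral>\<^sup>+x. (\<integral>\<^sup>+a. ennreal \<bar>v x - k\<bar> * indicator (near a) x \<partial>count_space A) \<partial>lborel)"
  proof (rule nn_integral_mono)
    fix x
    show "ennreal \<bar>v x - k\<bar> * indicator G x \<le> (\<integral>\<^sup>+a. ennreal \<bar>v x - k\<bar> * indicator (near a) x \<partial>count_space A)"
    proof (cases "x \<in> G")
      case True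
      then obtain b where b: "b \<in> A" "x \<in> near b" using subsetD[OF cover True] by blast
      have "ennreal \<bar>v x - k\<bar> * indicator G x = (\<integral>\<^sup>+a. ennreal \<bar>v x - k\<bar> * indicator {b} a \<partial>count_space A)"
        using b True by (simp add: nn_integral_cmult_indicator emeasure_count_space_finite)
      also have "\<dots> \<le> (\<integral>\<^sup>+a. ennreal \<bar>v x - k\<bar> * indicator (near a) x \<partial>count_space A)"
      proof (intro nn_integral_mono mult_left_mono)
        fix a show "indicator {b} a \<le> (indicator (near a) x :: ennreal)"
          using b(2) by (cases "a = b") simp_all
      qed simp
      finally show ?thesis .
    qed simp
  qed
  also have "\<dots> = (\<integral>\<^sup>+a. (\<integral>\<^sup>+x. ennreal \<bar>v x - k\<bar> * indicator (near a) x \<partial>lborel) \<partial>count_space A)"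
  proof (rule nn_integral_count_space_nn_integral[OF cA])
    fix a
    have [measurable]: "near a \<in> sets borel" by simp
    show "(\<lambda>x. ennreal \<bar>v x - k\<bar> * indicator (near a) x) \<in> borel_measurable lborel" by measurable
  qed
  finally show ?thesis .
qed

text \<open>On \<open>near a\<close> the deviation from the average over \<open>near a0\<close>
  splits into the oscillation around the average over \<open>near a\<close> and the difference of
  the two averages; both are dominated by the chain sum of \<open>h\<close>. The two terms of
  \<open>h\<close> are then summed separately over \<open>A\<close>.\<close>

lemma chain_poincare:
  fixes p q s \<beta> \<eta> \<tau> M K :: real
  assumes p: "p > 1" and q: "q \<ge> 0" and s: "s > 0" and \<tau>: "100 * \<epsilon> \<le> \<tau>" and K: "K > 0"
    and \<beta>: "\<beta> * (p - 1) = q - 2 * real DIM('a) + real DIM('a) / s"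
    and C: "\<And>a. a \<in> A \<Longrightarrow> finite (C a)" "\<And>a. a \<in> A \<Longrightarrow> a \<in> C a" "\<And>a. a \<in> A \<Longrightarrow> C a \<subseteq> A"
    and chain: "\<And>a. a \<in> A \<Longrightarrow> \<forall>(f :: 'a \<Rightarrow> real) g. (\<forall>r\<in>A. 0 \<le> g r) \<longrightarrow>
        (\<forall>r\<in>A. \<forall>t\<in>A. adjacent r t \<longrightarrow> \<bar>f r - f t\<bar> \<le> g r) \<longrightarrow> \<bar>f a - f a0\<bar> \<le> (\<Sum>r\<in>C a. g r)"
    and sum\<beta>: "\<And>a. a \<in> A \<Longrightarrow> (\<Sum>r\<in>C a. d r powr \<beta>) \<le> K * d a powr - \<eta>"
    and shadow: "\<And>a r. a \<in> A \<Longrightarrow> r \<in> C a \<Longrightarrow> dist a r + d a \<le> K * d r powr (1 / s)"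
    and M: "(\<integral>\<^sup>+a. ennreal (d a ^ DIM('a) * d a powr - \<eta>) \<partial>count_space A) \<le> ennreal M" "M \<ge> 0"
  shows "\<exists>c\<ge>0. \<forall>v J. v \<in> borel_measurable borel \<longrightarrow> integrable lborel (\<lambda>y. indicator G y *\<^sub>R v y) \<longrightarrow> J > 0 \<longrightarrow>
    (\<integral>\<^sup>+x. (\<integral>\<^sup>+y. gagliardo v p q x y * indicator (G \<inter> ball x (\<tau> * d x)) y \<partial>lborel) * indicator G x \<partial>lborel) \<le> ennreal J \<longrightarrow>
    (\<exists>k. (\<integral>\<^sup>+x. ennreal \<bar>v x - k\<bar> * indicator G x \<partial>lborel) \<le> ennreal (c * J powr (1 / p)))"
proof -
  define n where "n = DIM('a)"
  define \<omega> where "\<omega> = unit_ball_vol (real n) * (5 * \<epsilon>) ^ n"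
  have \<omega>: "\<omega> > 0" using eps by (simp add: \<omega>_def)
  define c1 :: real where "c1 = 32 ^ n"
  define c2 where "c2 = 2 ^ n * (40 * \<epsilon>) powr q / \<omega>\<^sup>2"
  have c12: "c1 \<ge> 0" "c2 \<ge> 0" using \<omega> by (auto simp: c1_def c2_def)
  define S where "S = (K / \<epsilon>) ^ n"
  define L where "L = (2 / \<epsilon>) ^ n"
  have SL: "S \<ge> 0" "L \<ge> 0" using K eps by (auto simp: S_def L_def)
  define c where "c = 2 * \<omega> * c1 * K * M + 2 * \<omega> * c2 * S * L"
  have c: "c \<ge> 0" unfolding c_def using \<omega> c12 K M SL by simp
  have "\<exists>k. (\<integral>\<^sup>+x. ennreal \<bar>v x - k\<bar> * indicator G x \<partial>lborel) \<le> ennreal (c * J powr (1 / p))"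
    if v: "v \<in> borel_measurable borel" and iv: "integrable lborel (\<lambda>y. indicator G y *\<^sub>R v y)" and J: "J > 0"
      and IJ: "(\<integral>\<^sup>+x. (\<integral>\<^sup>+y. gagliardo v p q x y * indicator (G \<inter> ball x (\<tau> * d x)) y \<partial>lborel) * indicator G x \<partial>lborel) \<le> ennreal J"
    for v :: "'a \<Rightarrow> real" and J :: real
  proof -
    note v[measurable]
    have sumE: "(\<integral>\<^sup>+a. energy v p q a \<partial>count_space A) \<le> ennreal (L * J)"
    proof -
      have "(\<integral>\<^sup>+a. energy v p q a \<partial>count_space A) \<le> ennreal L * ennreal J"
        unfolding L_def n_def by (rule order.trans[OF sum_energy_le[OF v \<tau>] mult_left_mono[OF IJ]]) simp
      thus ?thesis using SL J by (simp add: ennreal_mult)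
    qed
    have fin: "energy v p q a < \<infinity>" if "a \<in> A" for a
    proof -
      have "energy v p q a \<le> (\<integral>\<^sup>+a. energy v p q a \<partial>count_space A)"
        by (rule nn_integral_ge_point[OF that])
      also have "\<dots> \<le> ennreal (L * J)" by (rule sumE)
      also have "\<dots> < \<infinity>" by simp
      finally show ?thesis .
    qed
    define I where "I a = enn2real (energy v p q a)" for a
    have I: "I a \<ge> 0" for a by (simp add: I_def)
    have enI: "energy v p q a = ennreal (I a)" if "a \<in> A" for a
      using fin[OF that] by (simp add: I_def less_top)
    \<comment> \<open>The terms of \<open>h\<close> carry \<open>J powr (1 / p)\<close> and
      \<open>J powr (1 / p - 1)\<close>; the energy sum contributes another factor \<open>J\<close>
      to the second, so both end with the power \<open>1 / p\<close>.\<close>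
    define J1 where "J1 = J powr (1 / p)"
    define J2 where "J2 = J powr (1 / p - 1)"
    have J12: "J1 \<ge> 0" "J2 \<ge> 0" "J2 * J = J1"
    proof -
      have "J2 * J = J powr (1 / p - 1) * J powr 1" using J by (simp add: J2_def)
      also have "\<dots> = J1" unfolding J1_def powr_add[symmetric] by simp
      finally show "J2 * J = J1" .
    qed (auto simp: J1_def J2_def)
    define w where "w r = d r powr - (real n / s) * I r" for r
    have w: "w r \<ge> 0" for r using I by (simp add: w_def)
    define h where "h r = c1 * (J1 * d r powr \<beta>) + c2 * (J2 * w r)" for r
    have h: "h r \<ge> 0" for r unfolding h_def using c12 J12 w by simp
    define f where "f a = avg v (near a)" for a
    have m: "measure lborel (near a) = \<omega> * d a ^ n" for a
      using measure_cball_eq(1)[of 5 a] by (simp add: \<omega>_def n_def)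
    have loc: "(\<integral>\<^sup>+x. ennreal \<bar>v x - f a\<bar> * indicator (near a) x \<partial>lborel) \<le> ennreal (\<omega> * d a ^ n * h a)" if "a \<in> A" for a
      using local_poincare(1)[OF v iv p q J \<beta> that fin[OF that]]
      unfolding m f_def h_def w_def c1_def c2_def J1_def J2_def I_def \<omega>_def n_def .
    have adj: "\<bar>f a - f b\<bar> \<le> h a" if "a \<in> A" "b \<in> A" "adjacent a b" for a b
      using local_poincare(2)[OF v iv p q J \<beta> that(1) fin[OF that(1)] that(2,3)]
      unfolding f_def h_def w_def c1_def c2_def J1_def J2_def I_def \<omega>_def n_def .
    have diff: "\<bar>f a - f a0\<bar> \<le> (\<Sum>r\<in>C a. h r)" if "a \<in> A" for a
      using chain[OF that, THEN spec[of _ f], THEN spec[of _ h]] h adj by blast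
    have each: "(\<integral>\<^sup>+x. ennreal \<bar>v x - f a0\<bar> * indicator (near a) x \<partial>lborel) \<le> ennreal (2 * \<omega> * d a ^ n * (\<Sum>r\<in>C a. h r))"
      if a: "a \<in> A" for a
    proof -
      have na: "near a \<in> sets borel" by simp
      note na[measurable]
      have "(\<integral>\<^sup>+x. ennreal \<bar>v x - f a0\<bar> * indicator (near a) x \<partial>lborel) \<le>
        (\<integral>\<^sup>+x. ennreal \<bar>v x - f a\<bar> * indicator (near a) x + ennreal \<bar>f a - f a0\<bar> * indicator (near a) x \<partial>lborel)"
      proof (rule nn_integral_mono)
        fix x
        have "ennreal \<bar>v x - f a0\<bar> \<le> ennreal (\<bar>v x - f a\<bar> + \<bar>f a - f a0\<bar>)"
          by (rule ennreal_leI) linarith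
        also have "\<dots> = ennreal \<bar>v x - f a\<bar> + ennreal \<bar>f a - f a0\<bar>" by (rule ennreal_plus) auto
        finally show "ennreal \<bar>v x - f a0\<bar> * indicator (near a) x \<le>
           ennreal \<bar>v x - f a\<bar> * indicator (near a) x + ennreal \<bar>f a - f a0\<bar> * indicator (near a) x"
          unfolding distrib_right[symmetric] by (rule mult_right_mono) simp
      qed
      also have "\<dots> = (\<integral>\<^sup>+x. ennreal \<bar>v x - f a\<bar> * indicator (near a) x \<partial>lborel) + ennreal \<bar>f a - f a0\<bar> * emeasure lborel (near a)"
        by (subst nn_integral_add) (simp_all add: nn_integral_cmult_indicator)
      also have "emeasure lborel (near a) = ennreal (\<omega> * d a ^ n)"
        using measure_cball_eq(2)[of 5 a] by (simp add: \<omega>_def n_def)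
      also have "ennreal \<bar>f a - f a0\<bar> * ennreal (\<omega> * d a ^ n) = ennreal (\<omega> * d a ^ n * \<bar>f a - f a0\<bar>)"
        using \<omega> by (simp add: ennreal_mult[symmetric] infdist_nonneg mult.commute)
      also have "(\<integral>\<^sup>+x. ennreal \<bar>v x - f a\<bar> * indicator (near a) x \<partial>lborel) + ennreal (\<omega> * d a ^ n * \<bar>f a - f a0\<bar>)
        \<le> ennreal (\<omega> * d a ^ n * (\<Sum>r\<in>C a. h r)) + ennreal (\<omega> * d a ^ n * (\<Sum>r\<in>C a. h r))"
      proof (intro add_mono ennreal_leI mult_left_mono diff a)
        \<comment> \<open>Since \<open>a\<close> belongs to its own chain, the chain sum also covers
          the local oscillation; this produces the factor 2.\<close>
        have "h a \<le> (\<Sum>r\<in>C a. h r)"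
          by (rule member_le_sum) (use C[OF a] h in auto)
        hence "\<omega> * d a ^ n * h a \<le> \<omega> * d a ^ n * (\<Sum>r\<in>C a. h r)"
          using \<omega> by (intro mult_left_mono) (simp_all add: infdist_nonneg)
        thus "(\<integral>\<^sup>+x. ennreal \<bar>v x - f a\<bar> * indicator (near a) x \<partial>lborel) \<le> ennreal (\<omega> * d a ^ n * (\<Sum>r\<in>C a. h r))"
          by (rule order.trans[OF loc[OF a] ennreal_leI])
      qed (use \<omega> in \<open>simp add: infdist_nonneg\<close>)
      also have "\<dots> = ennreal (2 * \<omega> * d a ^ n * (\<Sum>r\<in>C a. h r))"
        using \<omega> h by (subst ennreal_plus[symmetric]) (simp_all add: infdist_nonneg sum_nonneg mult_ac)
      finally show ?thesis .
    qed
    have split: "ennreal (2 * \<omega> * d a ^ n * (\<Sum>r\<in>C a. h r)) \<le>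
        ennreal (2 * \<omega> * c1 * J1 * K) * ennreal (d a ^ n * d a powr - \<eta>) +
        ennreal (2 * \<omega> * c2 * J2) * (ennreal (d a ^ n) * (\<Sum>r\<in>C a. ennreal (w r)))" if a: "a \<in> A" for a
    proof -
      have dn: "d a ^ n \<ge> 0" by (simp add: infdist_nonneg)
      have sw: "0 \<le> (\<Sum>r\<in>C a. w r)" by (intro sum_nonneg w)
      have "(\<Sum>r\<in>C a. h r) = c1 * J1 * (\<Sum>r\<in>C a. d r powr \<beta>) + c2 * J2 * (\<Sum>r\<in>C a. w r)"
        unfolding h_def sum.distrib sum_distrib_left mult.assoc ..
      also have "\<dots> \<le> c1 * J1 * (K * d a powr - \<eta>) + c2 * J2 * (\<Sum>r\<in>C a. w r)"
        using c12 J12 by (intro add_mono mult_left_mono sum\<beta> a) auto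
      finally have "2 * \<omega> * d a ^ n * (\<Sum>r\<in>C a. h r) \<le> 2 * \<omega> * d a ^ n * (c1 * J1 * (K * d a powr - \<eta>) + c2 * J2 * (\<Sum>r\<in>C a. w r))"
        using \<omega> dn by (intro mult_left_mono) auto
      also have "\<dots> = (2 * \<omega> * c1 * J1 * K) * (d a ^ n * d a powr - \<eta>) + (2 * \<omega> * c2 * J2) * (d a ^ n * (\<Sum>r\<in>C a. w r))"
        unfolding distrib_left by (simp only: mult_ac)
      finally have "ennreal (2 * \<omega> * d a ^ n * (\<Sum>r\<in>C a. h r)) \<le>
        ennreal ((2 * \<omega> * c1 * J1 * K) * (d a ^ n * d a powr - \<eta>) + (2 * \<omega> * c2 * J2) * (d a ^ n * (\<Sum>r\<in>C a. w r)))"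
        by (rule ennreal_leI)
      also have "\<dots> = ennreal ((2 * \<omega> * c1 * J1 * K) * (d a ^ n * d a powr - \<eta>)) + ennreal ((2 * \<omega> * c2 * J2) * (d a ^ n * (\<Sum>r\<in>C a. w r)))"
        using \<omega> c12 J12 K dn sw by (intro ennreal_plus) simp_all
      also have "ennreal ((2 * \<omega> * c1 * J1 * K) * (d a ^ n * d a powr - \<eta>)) = ennreal (2 * \<omega> * c1 * J1 * K) * ennreal (d a ^ n * d a powr - \<eta>)"
        using \<omega> c12 J12 K dn by (intro ennreal_mult) simp_all
      also have "ennreal ((2 * \<omega> * c2 * J2) * (d a ^ n * (\<Sum>r\<in>C a. w r))) = ennreal (2 * \<omega> * c2 * J2) * ennreal (d a ^ n * (\<Sum>r\<in>C a. w r))"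
        using \<omega> c12 J12 K dn sw by (intro ennreal_mult) simp_all
      also have "ennreal (d a ^ n * (\<Sum>r\<in>C a. w r)) = ennreal (d a ^ n) * ennreal (\<Sum>r\<in>C a. w r)"
        using dn sw by (intro ennreal_mult)
      also have "ennreal (\<Sum>r\<in>C a. w r) = (\<Sum>r\<in>C a. ennreal (w r))" using w by (intro sum_ennreal[symmetric])
      finally show ?thesis .
    qed
    \<comment> \<open>After exchanging the sums, the shadow bound contributes
      \<open>d r powr (n / s)\<close>, the exact inverse of the weight in \<open>w r\<close>, and
      only the energy sum remains.\<close>
    have second: "(\<integral>\<^sup>+a. ennreal (d a ^ n) * (\<Sum>r\<in>C a. ennreal (w r)) \<partial>count_space A) \<le> ennreal (S * L * J)"
    proof -
      have "(\<integral>\<^sup>+a. ennreal (d a ^ n) * (\<Sum>r\<in>C a. ennreal (w r)) \<partial>count_space A) =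
         (\<integral>\<^sup>+r. ennreal (w r) * (\<integral>\<^sup>+a. ennreal (d a ^ n) * indicator {a. r \<in> C a} a \<partial>count_space A) \<partial>count_space A)"
        by (rule nn_integral_swap_chains[OF C(3,1)])
      also have "\<dots> \<le> (\<integral>\<^sup>+r. ennreal S * energy v p q r \<partial>count_space A)"
      proof (rule nn_integral_mono)
        fix r assume "r \<in> space (count_space A)"
        hence r: "r \<in> A" by simp
        have dr: "d r > 0" using d_pos r AG by auto
        have "ennreal (w r) * (\<integral>\<^sup>+a. ennreal (d a ^ n) * indicator {a. r \<in> C a} a \<partial>count_space A)
          \<le> ennreal (w r) * ennreal (S * d r powr (real n / s))"
          unfolding S_def n_def by (intro mult_left_mono shadow_bound[OF K s r shadow]) auto
        also have "\<dots> = ennreal (w r * (S * d r powr (real n / s)))"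
          using w SL by (intro ennreal_mult[symmetric]) auto
        also have "w r * (S * d r powr (real n / s)) = S * (d r powr - (real n / s) * d r powr (real n / s)) * I r"
          by (simp add: w_def mult_ac)
        also have "d r powr - (real n / s) * d r powr (real n / s) = 1"
          using dr by (simp add: powr_add[symmetric])
        also have "ennreal (S * 1 * I r) = ennreal S * energy v p q r"
          using SL I enI[OF r] by (simp add: ennreal_mult)
        finally show "ennreal (w r) * (\<integral>\<^sup>+a. ennreal (d a ^ n) * indicator {a. r \<in> C a} a \<partial>count_space A) \<le> ennreal S * energy v p q r" .
      qed
      also have "\<dots> = ennreal S * (\<integral>\<^sup>+r. energy v p q r \<partial>count_space A)" by (rule nn_integral_cmult) simp
      also have "\<dots> \<le> ennreal S * ennreal (L * J)" by (intro mult_left_mono sumE) simp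
      also have "\<dots> = ennreal (S * L * J)" using SL J by (simp add: ennreal_mult[symmetric] mult.assoc)
      finally show ?thesis .
    qed
    have "(\<integral>\<^sup>+x. ennreal \<bar>v x - f a0\<bar> * indicator G x \<partial>lborel) \<le>
        (\<integral>\<^sup>+a. (\<integral>\<^sup>+x. ennreal \<bar>v x - f a0\<bar> * indicator (near a) x \<partial>lborel) \<partial>count_space A)"
      by (rule nn_integral_near_cover_le[OF v])
    also have "\<dots> \<le> (\<integral>\<^sup>+a. ennreal (2 * \<omega> * c1 * J1 * K) * ennreal (d a ^ n * d a powr - \<eta>) +
        ennreal (2 * \<omega> * c2 * J2) * (ennreal (d a ^ n) * (\<Sum>r\<in>C a. ennreal (w r))) \<partial>count_space A)"
      by (rule nn_integral_mono) (rule order.trans[OF each split], simp_all)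
    also have "\<dots> = ennreal (2 * \<omega> * c1 * J1 * K) * (\<integral>\<^sup>+a. ennreal (d a ^ n * d a powr - \<eta>) \<partial>count_space A) +
        ennreal (2 * \<omega> * c2 * J2) * (\<integral>\<^sup>+a. ennreal (d a ^ n) * (\<Sum>r\<in>C a. ennreal (w r)) \<partial>count_space A)"
      by (subst nn_integral_add) (simp_all add: nn_integral_cmult)
    also have "\<dots> \<le> ennreal (2 * \<omega> * c1 * J1 * K) * ennreal M + ennreal (2 * \<omega> * c2 * J2) * ennreal (S * L * J)"
      using M(1) by (intro add_mono mult_left_mono second) (simp_all add: n_def)
    also have "\<dots> = ennreal ((2 * \<omega> * c1 * J1 * K) * M) + ennreal ((2 * \<omega> * c2 * J2) * (S * L * J))"
      using \<omega> c12 J12 K M SL J by (subst (1 2) ennreal_mult[symmetric]) simp_all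
    also have "\<dots> = ennreal ((2 * \<omega> * c1 * J1 * K) * M + (2 * \<omega> * c2 * J2) * (S * L * J))"
      using \<omega> c12 J12 K M SL J by (intro ennreal_plus[symmetric]) simp_all
    also have "(2 * \<omega> * c1 * J1 * K) * M + (2 * \<omega> * c2 * J2) * (S * L * J) = 2 * \<omega> * c1 * K * M * J1 + 2 * \<omega> * c2 * S * L * (J2 * J)"
      by (simp only: mult_ac)
    also have "\<dots> = c * J powr (1 / p)" unfolding J12(3) c_def J1_def by (simp only: distrib_right)
    finally show ?thesis by blast
  qed
  thus ?thesis using c by blast
qed

end

section \<open>The inequality for Lebesgue measurable functions\<close>

text \<open>The mean differs from \<open>k\<close> by at most the mean of
  \<open>\<bar>f x - k\<bar>\<close>, so the triangle inequality gives the factor 2. Hence any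
  constant can stand in for the mean.\<close>

lemma (in finite_measure) integral_abs_diff_mean_le:
  fixes f :: "'a \<Rightarrow> real"
  assumes f: "integrable M f" and pos: "measure M (space M) > 0"
  shows "(LINT x|M. \<bar>f x - (LINT x|M. f x) / measure M (space M)\<bar>) \<le> 2 * (LINT x|M. \<bar>f x - k\<bar>)"
proof -
  define m where "m = measure M (space M)"
  define a where "a = (LINT x|M. f x) / m"
  have fk: "integrable M (\<lambda>x. f x - k)" for k using f by auto
  have "m * (a - k) = (LINT x|M. f x - k)"
    using f pos by (simp add: a_def m_def right_diff_distrib)
  hence "m * \<bar>a - k\<bar> = \<bar>LINT x|M. f x - k\<bar>"
    using pos by (metis abs_mult abs_of_pos m_def)
  also have "\<dots> \<le> (LINT x|M. \<bar>f x - k\<bar>)"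
    using integral_norm_bound[of M "\<lambda>x. f x - k"] by simp
  finally have 1: "m * \<bar>a - k\<bar> \<le> (LINT x|M. \<bar>f x - k\<bar>)" .
  have "(LINT x|M. \<bar>f x - a\<bar>) \<le> (LINT x|M. \<bar>f x - k\<bar> + \<bar>a - k\<bar>)"
    using fk by (intro integral_mono Bochner_Integration.integrable_add integrable_abs integrable_const) auto
  also have "\<dots> = (LINT x|M. \<bar>f x - k\<bar>) + m * \<bar>a - k\<bar>"
    using fk by (subst Bochner_Integration.integral_add) (auto simp: m_def)
  finally show ?thesis using 1 by (simp add: a_def m_def)
qed

text \<open>The main estimate uses Borel measurability on the product space, so \<open>u\<close> is
  first changed on a null set.\<close>

lemma borel_representative:
  fixes u :: "'a::euclidean_space \<Rightarrow> real"
  assumes G: "G \<in> sets borel" and u: "integrable (lebesgue_on G) u"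
  obtains v where "v \<in> borel_measurable borel" "AE x in lborel. x \<in> G \<longrightarrow> u x = v x"
    "integrable lborel (\<lambda>x. indicator G x *\<^sub>R v x)"
proof -
  have iu: "integrable lebesgue (\<lambda>x. indicator G x *\<^sub>R u x)"
    using u G by (subst (asm) integrable_restrict_space) auto
  hence "(\<lambda>x. indicator G x *\<^sub>R u x) \<in> borel_measurable lebesgue" by (rule borel_measurable_integrable)
  then obtain v where v: "v \<in> borel_measurable lborel" "AE x in lborel. indicator G x *\<^sub>R u x = v x"
    using completion_ex_borel_measurable_real by blast
  have v': "v \<in> borel_measurable borel" using v(1) by simp
  have ae: "AE x in lborel. x \<in> G \<longrightarrow> u x = v x"
    using v(2) by eventually_elim (auto simp: indicator_def)
  have ae0: "AE x in lborel. indicator G x *\<^sub>R u x = indicator G x *\<^sub>R v x"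
    using ae by eventually_elim (auto simp: indicator_def)
  have m: "(\<lambda>x. indicator G x *\<^sub>R v x) \<in> borel_measurable lborel"
    using v' G by simp
  have "integrable lebesgue (\<lambda>x. indicator G x *\<^sub>R v x)"
  proof (rule integrable_cong_AE_imp[OF iu])
    show "(\<lambda>x. indicator G x *\<^sub>R v x) \<in> borel_measurable lebesgue" using m by (rule measurable_completion)
    show "AE x in lebesgue. indicator G x *\<^sub>R u x = indicator G x *\<^sub>R v x"
      by (rule AE_completion[OF ae0])
  qed
  hence "integrable lborel (\<lambda>x. indicator G x *\<^sub>R v x)"
    using integrable_completion[OF m] by simp
  thus ?thesis using that v' ae by blast
qed

text \<open>Completing a measure leaves the nonnegative integral of an arbitrary function
  unchanged.\<close>

lemma nn_integral_lebesgue_on_eq: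
  assumes "G \<in> sets borel"
  shows "(\<integral>\<^sup>+x. f x \<partial>lebesgue_on G) = (\<integral>\<^sup>+x. f x * indicator G x \<partial>lborel)"
proof -
  have "(\<integral>\<^sup>+x. f x \<partial>lebesgue_on G) = (\<integral>\<^sup>+x. f x * indicator G x \<partial>lebesgue)"
    using assms by (intro nn_integral_restrict_space) auto
  thus ?thesis by (simp add: nn_integral_completion)
qed

text \<open>The exceptional null set is discarded twice: in the outer variable, and then for each
  remaining \<open>x\<close> in the inner one.\<close>

lemma nn_integral_gagliardo_lebesgue_on_eq:
  fixes u v :: "'a::euclidean_space \<Rightarrow> real"
  assumes G: "G \<in> sets borel" and ae: "AE x in lborel. x \<in> G \<longrightarrow> u x = v x"
  shows "(\<integral>\<^sup>+x. (\<integral>\<^sup>+y. gagliardo u p q x y \<partial>lebesgue_on (G \<inter> ball x (r x))) \<partial>lebesgue_on G) =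
    (\<integral>\<^sup>+x. (\<integral>\<^sup>+y. gagliardo v p q x y * indicator (G \<inter> ball x (r x)) y \<partial>lborel) * indicator G x \<partial>lborel)"
proof -
  have "(\<integral>\<^sup>+x. (\<integral>\<^sup>+y. gagliardo u p q x y \<partial>lebesgue_on (G \<inter> ball x (r x))) \<partial>lebesgue_on G) =
    (\<integral>\<^sup>+x. (\<integral>\<^sup>+y. gagliardo u p q x y * indicator (G \<inter> ball x (r x)) y \<partial>lborel) * indicator G x \<partial>lborel)"
    using G by (simp add: nn_integral_lebesgue_on_eq)
  also have "\<dots> = (\<integral>\<^sup>+x. (\<integral>\<^sup>+y. gagliardo v p q x y * indicator (G \<inter> ball x (r x)) y \<partial>lborel) * indicator G x \<partial>lborel)"
  proof (rule nn_integral_cong_AE)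
    show "AE x in lborel. (\<integral>\<^sup>+y. gagliardo u p q x y * indicator (G \<inter> ball x (r x)) y \<partial>lborel) * indicator G x =
       (\<integral>\<^sup>+y. gagliardo v p q x y * indicator (G \<inter> ball x (r x)) y \<partial>lborel) * indicator G x"
      using ae
    proof eventually_elim
      case (elim x)
      show ?case
      proof (cases "x \<in> G")
        case True
        hence ux: "u x = v x" using elim by simp
        have "(\<integral>\<^sup>+y. gagliardo u p q x y * indicator (G \<inter> ball x (r x)) y \<partial>lborel) =
          (\<integral>\<^sup>+y. gagliardo v p q x y * indicator (G \<inter> ball x (r x)) y \<partial>lborel)"
        proof (rule nn_integral_cong_AE)
          show "AE y in lborel. gagliardo u p q x y * indicator (G \<inter> ball x (r x)) y =
            gagliardo v p q x y * indicator (G \<inter> ball x (r x)) y"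
            using ae by eventually_elim (auto simp: indicator_def gagliardo_def ux)
        qed
        thus ?thesis by simp
      qed simp
    qed
  qed
  finally show ?thesis .
qed

text \<open>By \<open>le_add_powr\<close> with \<open>K = 1\<close> the function
  \<open>1 + \<bar>u x\<bar> powr p\<close> is a majorant, and constants are integrable for a finite
  measure.\<close>

lemma integrable_of_powr_integrable:
  fixes u :: "'a \<Rightarrow> real"
  assumes "finite_measure M" "u \<in> borel_measurable M" "integrable M (\<lambda>x. \<bar>u x\<bar> powr p)" "p \<ge> 1"
  shows "integrable M u"
proof (rule Bochner_Integration.integrable_bound)
  interpret finite_measure M by fact
  show "integrable M (\<lambda>x. 1 + \<bar>u x\<bar> powr p)" using assms by auto
  show "AE x in M. norm (u x) \<le> norm (1 + \<bar>u x\<bar> powr p)"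
  proof (rule AE_I2)
    fix x
    have "\<bar>u x\<bar> \<le> 1 + 1 powr (1 - p) * \<bar>u x\<bar> powr p" using assms by (intro le_add_powr) auto
    thus "norm (u x) \<le> norm (1 + \<bar>u x\<bar> powr p)" by simp
  qed
qed (use assms in simp)

text \<open>For \<open>i > 0\<close> take \<open>J = i\<close>. The case \<open>i = 0\<close> is a
  limit of small \<open>J\<close>; it treats functions of zero energy, for which the main estimate
  offers only positive \<open>J\<close>.\<close>

lemma le_const_powr_imp_le:
  fixes y c i p :: real
  assumes "\<And>J. J > 0 \<Longrightarrow> i \<le> J \<Longrightarrow> y \<le> c * J powr (1 / p)" and "i \<ge> 0" "c \<ge> 0" "p > 0"
  shows "y \<le> c * i powr (1 / p)"
proof (cases "i = 0")
  case True
  have "y \<le> 0"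
  proof (rule ccontr)
    assume "\<not> y \<le> 0"
    hence y: "y > 0" by simp
    \<comment> \<open>With \<open>J = t powr p\<close> the hypothesis reads
      \<open>y \<le> c * t\<close>, while \<open>y = (c + 1) * t\<close>; the added 1 also handles
      \<open>c = 0\<close>.\<close>
    define t where "t = y / (c + 1)"
    have t: "t > 0" using y assms by (simp add: t_def)
    have "y \<le> c * (t powr p) powr (1 / p)" using t assms True by (intro assms(1)) auto
    also have "(t powr p) powr (1 / p) = t" using t assms by (simp add: powr_powr)
    also have "c * t < (c + 1) * t" using t by (simp add: algebra_simps)
    also have "(c + 1) * t = y" using assms by (simp add: t_def)
    finally show False by simp
  qed
  thus ?thesis using True by simp
qed (use assms in auto)

text \<open>Multiplied by \<open>p - 1\<close>, the inequality
  \<open>s * (1 - \<beta>) - 1 < n - lam\<close> is the hypothesis on \<open>p\<close> cleared of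
  its denominator. This leaves room for \<open>\<eta>\<close> between the two sides and for
  \<open>\<mu>\<close> between \<open>lam\<close> and \<open>n - \<eta>\<close>.\<close>

lemma exponent_choice:
  fixes n s p lam \<delta> :: real
  assumes "s > 1" "1 < p" "\<delta> < 1" "lam < n" "s < (n + 1 - lam) / (1 - \<delta>)"
    and "p > (s * (n - 1) - lam + 1) / (n - s * (1 - \<delta>) - lam + 1)"
  defines "\<beta> \<equiv> (\<delta> * p - n + n / s) / (p - 1)"
  obtains \<eta> \<mu> where "0 < \<eta>" "\<eta> < n - \<mu>" "lam < \<mu>" "1 - (1 + \<eta>) / s \<le> \<beta>"
proof -
  define Y where "Y = n - s * (1 - \<delta>) - lam + 1"
  \<comment> \<open>The hypothesis on \<open>s\<close> says that the denominator \<open>Y\<close> in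
    the hypothesis on \<open>p\<close> is positive, so it can be cleared.\<close>
  have "s * (1 - \<delta>) < n + 1 - lam" using assms by (simp add: pos_less_divide_eq)
  hence Y: "Y > 0" by (simp add: Y_def)
  have "s * (n - 1) - lam + 1 < p * Y"
    using assms(6) Y unfolding Y_def[symmetric] by (simp add: pos_divide_less_eq)
  moreover have "(n - lam) * (p - 1) - (s * (1 - \<beta>) - 1) * (p - 1) = p * Y - (s * (n - 1) - lam + 1)"
  proof -
    have b: "\<beta> * (p - 1) = \<delta> * p - n + n / s" using assms(2) by (simp add: \<beta>_def)
    have "s * (\<beta> * (p - 1)) = s * (\<delta> * p) - s * n + n"
      unfolding b using assms(1) by (simp add: algebra_simps)
    thus ?thesis by (simp add: Y_def algebra_simps)
  qed
  ultimately have "(s * (1 - \<beta>) - 1) * (p - 1) < (n - lam) * (p - 1)" by simp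
  hence lt: "s * (1 - \<beta>) - 1 < n - lam" using assms(2) by simp
  hence "max 0 (s * (1 - \<beta>) - 1) < n - lam" using assms(4) by simp
  then obtain \<eta> where \<eta>: "max 0 (s * (1 - \<beta>) - 1) < \<eta>" "\<eta> < n - lam" using dense by blast
  then obtain \<mu> where \<mu>: "lam < \<mu>" "\<mu> < n - \<eta>" using dense[of lam "n - \<eta>"] by auto
  have "(1 - \<beta>) * s \<le> 1 + \<eta>" using \<eta> by (simp add: mult.commute)
  hence "1 - \<beta> \<le> (1 + \<eta>) / s" using assms(1) by (simp add: pos_le_divide_eq)
  thus ?thesis using that[of \<eta> \<mu>] \<eta> \<mu> by simp
qed

text \<open>For infinite energy the inequality is trivial, whereas \<open>enn2real\<close> would
  turn the energy into 0; hence the guard \<open>I < \<infinity>\<close>.\<close>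

theorem theorem5p1:
  fixes G :: "'a::euclidean_space set"
    and s p lam \<delta> \<tau> :: real
  defines "n \<equiv> real DIM('a)"
  assumes "DIM('a) \<ge> 2"
    and "s > 1" and "1 < p" and "n - 1 \<le> lam" and "lam < n"
    and "0 < \<delta>" and "\<delta> < 1" and "0 < \<tau>" and "\<tau> < 1"
    and "s < (n + 1 - lam) / (1 - \<delta>)"
    and "p > (s * (n - 1) - lam + 1) / (n - s * (1 - \<delta>) - lam + 1)"
    and "s_john_domain s G"
    and "minkowski_dim (frontier G) \<le> lam"
  shows "\<exists>c::real. \<forall>u :: 'a \<Rightarrow> real.
     u \<in> borel_measurable (lebesgue_on G) \<and>
     integrable (lebesgue_on G) (\<lambda>x. \<bar>u x\<bar> powr p) \<longrightarrow>
     (let uG = (LINT x|lebesgue_on G. u x) / measure lebesgue G;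
          I = (\<integral>\<^sup>+ x. (\<integral>\<^sup>+ y. ennreal (\<bar>u x - u y\<bar> powr p / norm (x - y) powr (n + \<delta> * p))
                 \<partial>(lebesgue_on (G \<inter> ball x (\<tau> * infdist x (frontier G))))) \<partial>(lebesgue_on G))
      in I < \<infinity> \<longrightarrow>
         (LINT x|lebesgue_on G. \<bar>u x - uG\<bar>) \<le> c * enn2real I powr (1 / p))"
proof -
  note n_gt = \<open>n - 1 \<le> lam\<close> \<open>lam < n\<close>
  note s = \<open>s > 1\<close> and p = \<open>1 < p\<close> and \<tau> = \<open>0 < \<tau>\<close> \<open>\<tau> < 1\<close> and \<delta> = \<open>0 < \<delta>\<close> \<open>\<delta> < 1\<close>
  note john = \<open>s_john_domain s G\<close> and dim = \<open>minkowski_dim (frontier G) \<le> lam\<close>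
  have G: "open G" "bounded G" "G \<noteq> {}" using john by (auto simp: s_john_domain_def)
  have Gb: "G \<in> sets borel" using G by auto
  define q where "q = n + \<delta> * p"
  have q: "q \<ge> 0" using p \<delta> by (simp add: q_def n_def)
  define \<beta> where "\<beta> = (\<delta> * p - n + n / s) / (p - 1)"
  obtain \<eta> \<mu> where \<eta>: "0 < \<eta>" "\<eta> < n - \<mu>" "lam < \<mu>" "1 - (1 + \<eta>) / s \<le> \<beta>"
    unfolding \<beta>_def
    by (rule exponent_choice[OF s p \<delta>(2) n_gt(2) \<open>s < (n + 1 - lam) / (1 - \<delta>)\<close>
          \<open>p > (s * (n - 1) - lam + 1) / (n - s * (1 - \<delta>) - lam + 1)\<close>])
  have \<beta>: "\<beta> * (p - 1) = q - 2 * real DIM('a) + real DIM('a) / s"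
    using p by (simp add: \<beta>_def q_def n_def)
  \<comment> \<open>The factor 100 serves two ends: \<open>\<tau> < 1\<close> yields
    \<open>\<epsilon> \<le> 1 / 100\<close> for the cover, and points of one wide ball respect the
    restriction to \<open>ball x (\<tau> * d x)\<close>.\<close>
  define \<epsilon> where "\<epsilon> = \<tau> / 100"
  have \<epsilon>: "0 < \<epsilon>" "\<epsilon> \<le> 1 / 100" "100 * \<epsilon> \<le> \<tau>" using \<tau> by (simp_all add: \<epsilon>_def)
  obtain A D where "whitney_cover G A \<epsilon> D"
    using whitney_cover_exists[OF G \<epsilon>(1,2)] by blast
  then interpret whitney_cover G A \<epsilon> D .
  obtain C :: "'a \<Rightarrow> 'a set" and a0 :: 'a and K :: real where K: "K > 0" and
    C: "\<And>a. a \<in> A \<Longrightarrow> finite (C a)" "\<And>a. a \<in> A \<Longrightarrow> a \<in> C a" "\<And>a. a \<in> A \<Longrightarrow> C a \<subseteq> A" and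
    chain: "\<And>a. a \<in> A \<Longrightarrow> \<forall>(f :: 'a \<Rightarrow> real) g. (\<forall>r\<in>A. 0 \<le> g r) \<longrightarrow>
        (\<forall>r\<in>A. \<forall>t\<in>A. adjacent r t \<longrightarrow> \<bar>f r - f t\<bar> \<le> g r) \<longrightarrow> \<bar>f a - f a0\<bar> \<le> (\<Sum>r\<in>C a. g r)" and
    sum\<beta>: "\<And>a. a \<in> A \<Longrightarrow> (\<Sum>r\<in>C a. d r powr \<beta>) \<le> K * d a powr - \<eta>" and
    shadow: "\<And>a r. a \<in> A \<Longrightarrow> r \<in> C a \<Longrightarrow> dist a r + d a \<le> K * d r powr (1 / s)"
  proof (rule exists_chains[OF s \<eta>(1,4) john], goal_cases)
    case (1 C a0 K)
    show ?case by (rule 1(1)[OF 1(2-8)])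
  qed
  obtain x0 where x0: "x0 \<in> G" using G(3) by blast
  have D0: "D > 0" using d_pos[OF x0] D[OF x0] by linarith
  have \<mu>0: "0 \<le> \<mu>" using n_gt \<eta>(3) DIM_positive[where 'a='a] unfolding n_def by linarith
  define M where "M = enn2real (\<integral>\<^sup>+a. ennreal (d a ^ DIM('a) * d a powr - \<eta>) \<partial>count_space A)"
  have M: "(\<integral>\<^sup>+a. ennreal (d a ^ DIM('a) * d a powr - \<eta>) \<partial>count_space A) \<le> ennreal M" "M \<ge> 0"
    using sum_d_finite[OF dim \<eta>(1) \<eta>(2)[unfolded n_def] \<eta>(3) \<mu>0 D0] by (simp_all add: M_def less_top)
  have s0: "s > 0" using s by simp
  obtain c where c: "c \<ge> 0" and main: "\<forall>v J. v \<in> borel_measurable borel \<longrightarrow>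
    integrable lborel (\<lambda>y. indicator G y *\<^sub>R v y) \<longrightarrow> J > 0 \<longrightarrow>
    (\<integral>\<^sup>+x. (\<integral>\<^sup>+y. gagliardo v p q x y * indicator (G \<inter> ball x (\<tau> * d x)) y \<partial>lborel) * indicator G x \<partial>lborel) \<le> ennreal J \<longrightarrow>
    (\<exists>k. (\<integral>\<^sup>+x. ennreal \<bar>v x - k\<bar> * indicator G x \<partial>lborel) \<le> ennreal (c * J powr (1 / p)))"
    by (atomize_elim, rule chain_poincare[OF p q s0 \<epsilon>(3) K \<beta> C chain sum\<beta> shadow M])
  have Gfin: "emeasure lebesgue G < \<infinity>"
    using emeasure_bounded_finite[OF G(2)] Gb by simp
  have Gpos: "measure lebesgue G > 0"
  proof -
    have "ball x0 (d x0) \<subseteq> G" by (rule ball_d_subset[OF x0])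
    hence "measure lebesgue (ball x0 (d x0)) \<le> measure lebesgue G"
      using Gfin Gb by (intro measure_mono_fmeasurable) (auto simp: fmeasurable_def)
    moreover have "0 < measure lebesgue (ball x0 (d x0))"
      using d_pos[OF x0] by (simp add: content_ball)
    ultimately show ?thesis by linarith
  qed
  interpret L: finite_measure "lebesgue_on G"
    by (rule finite_measureI) (use Gfin Gb in \<open>simp add: emeasure_restrict_space\<close>)
  have Gspace: "measure (lebesgue_on G) (space (lebesgue_on G)) = measure lebesgue G"
    using Gb by (simp add: measure_restrict_space)
  show ?thesis
  \<comment> \<open>The factor 2 comes from replacing the constant \<open>k\<close> of the main
    estimate by the mean of \<open>u\<close>.\<close>
  proof (intro exI[of _ "2 * c"] allI impI)
    fix u :: "'a \<Rightarrow> real"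
    assume u: "u \<in> borel_measurable (lebesgue_on G) \<and> integrable (lebesgue_on G) (\<lambda>x. \<bar>u x\<bar> powr p)"
    have iu: "integrable (lebesgue_on G) u"
      by (rule integrable_of_powr_integrable[where p = p]) (use u p L.finite_measure_axioms in auto)
    obtain v where v: "v \<in> borel_measurable borel" "AE x in lborel. x \<in> G \<longrightarrow> u x = v x"
      "integrable lborel (\<lambda>x. indicator G x *\<^sub>R v x)"
      using borel_representative[OF Gb iu] by blast
    define uG where "uG = (LINT x|lebesgue_on G. u x) / measure lebesgue G"
    define I where "I = (\<integral>\<^sup>+x. (\<integral>\<^sup>+y. gagliardo u p q x y \<partial>lebesgue_on (G \<inter> ball x (\<tau> * d x))) \<partial>lebesgue_on G)"
    have Iv: "I = (\<integral>\<^sup>+x. (\<integral>\<^sup>+y. gagliardo v p q x y * indicator (G \<inter> ball x (\<tau> * d x)) y \<partial>lborel) * indicator G x \<partial>lborel)"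
      unfolding I_def by (rule nn_integral_gagliardo_lebesgue_on_eq[OF Gb v(2)])
    have "(LINT x|lebesgue_on G. \<bar>u x - uG\<bar>) \<le> 2 * c * enn2real I powr (1 / p)" if fin: "I < \<infinity>"
    proof (rule le_const_powr_imp_le)
      fix J :: real assume J: "J > 0" "enn2real I \<le> J"
      have "I = ennreal (enn2real I)" using fin by (simp add: less_top)
      also have "\<dots> \<le> ennreal J" using J by (intro ennreal_leI)
      finally have "I \<le> ennreal J" .
      then obtain k where k: "(\<integral>\<^sup>+x. ennreal \<bar>v x - k\<bar> * indicator G x \<partial>lborel) \<le> ennreal (c * J powr (1 / p))"
        using main[rule_format, OF v(1,3) J(1)] unfolding Iv by blast
      have "ennreal (LINT x|lebesgue_on G. \<bar>u x - k\<bar>) = (\<integral>\<^sup>+x. ennreal \<bar>u x - k\<bar> \<partial>lebesgue_on G)"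
        using iu by (intro nn_integral_eq_integral[symmetric]) auto
      also have "\<dots> = (\<integral>\<^sup>+x. ennreal \<bar>u x - k\<bar> * indicator G x \<partial>lborel)"
        by (rule nn_integral_lebesgue_on_eq[OF Gb])
      also have "\<dots> = (\<integral>\<^sup>+x. ennreal \<bar>v x - k\<bar> * indicator G x \<partial>lborel)"
      proof (rule nn_integral_cong_AE)
        show "AE x in lborel. ennreal \<bar>u x - k\<bar> * indicator G x = ennreal \<bar>v x - k\<bar> * indicator G x"
          using v(2) by eventually_elim (auto simp: indicator_def)
      qed
      finally have "ennreal (LINT x|lebesgue_on G. \<bar>u x - k\<bar>) \<le> ennreal (c * J powr (1 / p))" using k by simp
      hence "(LINT x|lebesgue_on G. \<bar>u x - k\<bar>) \<le> c * J powr (1 / p)"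
        using c by (subst (asm) ennreal_le_iff) auto
      moreover have "(LINT x|lebesgue_on G. \<bar>u x - uG\<bar>) \<le> 2 * (LINT x|lebesgue_on G. \<bar>u x - k\<bar>)"
        using L.integral_abs_diff_mean_le[OF iu] Gpos unfolding Gspace uG_def by blast
      ultimately show "(LINT x|lebesgue_on G. \<bar>u x - uG\<bar>) \<le> 2 * c * J powr (1 / p)" by linarith
    qed (use c p in auto)
    thus "let uG = (LINT x|lebesgue_on G. u x) / measure lebesgue G;
          I = (\<integral>\<^sup>+ x. (\<integral>\<^sup>+ y. ennreal (\<bar>u x - u y\<bar> powr p / norm (x - y) powr (n + \<delta> * p))
                 \<partial>(lebesgue_on (G \<inter> ball x (\<tau> * infdist x (frontier G))))) \<partial>(lebesgue_on G))
      in I < \<infinity> \<longrightarrow> (LINT x|lebesgue_on G. \<bar>u x - uG\<bar>) \<le> 2 * c * enn2real I powr (1 / p)"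
      unfolding Let_def I_def uG_def gagliardo_def q_def by (rule impI)
  qed
qed

end
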